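(* Let $(X_1,Y_1),(X_2,Y_2),\dots$ be a random sample (i.i.d. copies) of a random vector $(X,Y)$ with continuous joint distribution function $H$, marginal distribution functions $F$ and $G$, and (unique) copula $A$. Assume that $A$ allows a continuous Markov kernel $K_A$, define $K_H(x,(-\infty,y]):=K_A(F(x),[0,G(y)])$, and set $N(n):=\lfloor n^s\rfloor$ for some $s\in(0,\tfrac12)$. Fix $\tau\in(0,1)$ and for $x\in\mathbb{R}$ define $$\underline q^\tau(x):=\sup\{y\in\mathbb{R}:K_H(x,(-\infty,y])<\tau\},\quad \overline q^\tau(x):=\inf\{y\in\mathbb{R}:K_H(x,(-\infty,y])>\tau\},$$ $$\underline q_n^\tau(x):=\sup\{y\in\mathbb{R}:K_{\mathcal{CB}_{N(n)}(E_n)}(F_n(x),[0,G_n(y)])<\tau\},\quad \overline q_n^\tau(x):=\inf\{y\in\mathbb{R}:K_{\mathcal{CB}_{N(n)}(E_n)}(F_n(x),[0,G_n(y)])>\tau\}.$$ Then for every $x\in\mathbb{R}$, almost surely, $$\lim_{n\to\infty}\max_{y_n\in[\underline q_n^\tau(x),\overline q_n^\tau(x)]}\ \min_{y\in[\underline q^\tau(x),\overline q^\tau(x)]}|y_n-y|=0.$$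
   Context: A (bivariate) copula is a distribution function on $[0,1]^2$ with uniform marginals; each copula $B$ corresponds to a doubly stochastic measure $\mu_B$ with $B(x,y)=\mu_B([0,x]\times[0,y])$. A Markov kernel of a copula $B$ is a map $K_B:[0,1]\times\mathcal{B}([0,1])\to[0,1]$, measurable in the first argument, a probability measure in the second, with $\int_{E_1}K_B(x,E_2)\,d\lambda(x)=\mu_B(E_1\times E_2)$ for all Borel $E_1,E_2\subseteq[0,1]$ ($\lambda$ = Lebesgue measure). $A$ allows a continuous Markov kernel if it has a version $K_A$ with $(x,y)\mapsto K_A(x,[0,y])$ continuous on $[0,1]^2$; $K_A$ denotes this version. Checkerboard approximation: $I_1^N=[0,\tfrac1N]$, $I_i^N=(\tfrac{i-1}N,\tfrac iN]$ ($i=2,\dots,N$), $Q_{i,j}^N=I_i^N\times I_j^N$; for a copula $B$, $K_{\mathcal{CB}_N(B)}(u,[0,v])=N^2\sum_{i,j=1}^N\mu_B(Q^N_{i,j})\mathbf 1_{I^N_i}(u)\,\lambda([0,v]\cap I^N_j)$ is the Markov kernel of the absolutely continuous copula $\mathcal{CB}_N(B)$ with density $N^2\sum_{i,j}\mu_B(Q^N_{i,j})\mathbf 1_{Q^N_{i,j}}$. $F_n,G_n$ are the univariate empirical distribution functions of the first $n$ observations; $E_n$ is the empirical copula: with $H_n$ the bivariate empirical distribution function, almost surely there is a unique subcopula $E_n'$ on $\{0,\tfrac1n,\dots,1\}^2$ with $H_n(x,y)=E_n'(F_n(x),G_n(y))$, and $E_n$ is its extension to a copula by bilinear interpolation on each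 square $[\tfrac{i-1}n,\tfrac in]\times[\tfrac{j-1}n,\tfrac jn]$. *)

theory Defs
  imports "HOL-Probability.Probability"
begin

definition is_copula :: "(real \<Rightarrow> real \<Rightarrow> real) \<Rightarrow> bool" where
  "is_copula A \<longleftrightarrow>
     (\<forall>u\<in>{0..1}. A u 0 = 0 \<and> A 0 u = 0 \<and> A u 1 = u \<and> A 1 u = u) \<and>
     (\<forall>u1\<in>{0..1}. \<forall>u2\<in>{0..1}. \<forall>v1\<in>{0..1}. \<forall>v2\<in>{0..1}.
        u1 \<le> u2 \<longrightarrow> v1 \<le> v2 \<longrightarrow> A u2 v2 - A u1 v2 - A u2 v1 + A u1 v1 \<ge> 0)"

definition is_dsm :: "(real \<Rightarrow> real \<Rightarrow> real) \<Rightarrow> (real \<times> real) measure \<Rightarrow> bool" where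
  "is_dsm B \<mu> \<longleftrightarrow> sets \<mu> = sets borel \<and> finite_measure \<mu> \<and>
     emeasure \<mu> (UNIV - {0..1} \<times> {0..1}) = 0 \<and>
     (\<forall>x\<in>{0..1}. \<forall>y\<in>{0..1}. measure \<mu> ({0..x} \<times> {0..y}) = B x y)"

definition dsm :: "(real \<Rightarrow> real \<Rightarrow> real) \<Rightarrow> (real \<times> real) measure" where
  "dsm B = (THE \<mu>. is_dsm B \<mu>)"

definition is_markov_kernel :: "(real \<Rightarrow> real \<Rightarrow> real) \<Rightarrow> (real \<Rightarrow> real measure) \<Rightarrow> bool" where
  "is_markov_kernel B K \<longleftrightarrow>
     (\<forall>x\<in>{0..1}. prob_space (K x) \<and> sets (K x) = sets borel \<and> measure (K x) {0..1} = 1) \<and>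
     (\<forall>E\<in>sets borel. (\<lambda>x. measure (K x) E) \<in> borel_measurable (restrict_space borel {0..1})) \<and>
     (\<forall>E1\<in>sets borel. \<forall>E2\<in>sets borel. E1 \<subseteq> {0..1} \<longrightarrow> E2 \<subseteq> {0..1} \<longrightarrow>
        (LINT x:E1|lborel. measure (K x) E2) = measure (dsm B) (E1 \<times> E2))"

definition is_continuous_markov_kernel :: "(real \<Rightarrow> real \<Rightarrow> real) \<Rightarrow> (real \<Rightarrow> real measure) \<Rightarrow> bool" where
  "is_continuous_markov_kernel B K \<longleftrightarrow> is_markov_kernel B K \<and>
     continuous_on ({0..1} \<times> {0..1}) (\<lambda>(x, y). measure (K x) {0..y})"

definition cb_I :: "nat \<Rightarrow> nat \<Rightarrow> real set" where
  "cb_I N i = (if i = 1 then {0..1 / real N} else {(real i - 1) / real N <.. real i / real N})"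

definition cb_Q :: "nat \<Rightarrow> nat \<Rightarrow> nat \<Rightarrow> (real \<times> real) set" where
  "cb_Q N i j = cb_I N i \<times> cb_I N j"

definition cb_kernel :: "nat \<Rightarrow> (real \<Rightarrow> real \<Rightarrow> real) \<Rightarrow> real \<Rightarrow> real \<Rightarrow> real" where
  "cb_kernel N B u v = (real N)^2 * (\<Sum>i\<in>{1..N}. \<Sum>j\<in>{1..N}.
      measure (dsm B) (cb_Q N i j) * indicator (cb_I N i) u * measure lborel ({0..v} \<inter> cb_I N j))"

definition emp_df :: "(nat \<Rightarrow> real) \<Rightarrow> nat \<Rightarrow> real \<Rightarrow> real" where
  "emp_df x n t = real (card {i. i < n \<and> x i \<le> t}) / real n"

definition emp_joint_df :: "(nat \<Rightarrow> real) \<Rightarrow> (nat \<Rightarrow> real) \<Rightarrow> nat \<Rightarrow> real \<Rightarrow> real \<Rightarrow> real" where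
  "emp_joint_df x y n s t = real (card {i. i < n \<and> x i \<le> s \<and> y i \<le> t}) / real n"

text \<open>A subcopula on the grid {0,1/n,...,1}^2, encoded by e i j = E'(i/n, j/n) for i,j \<le> n
  (and 0 outside the grid, to make it a unique object).\<close>
definition is_grid_subcopula :: "nat \<Rightarrow> (nat \<Rightarrow> nat \<Rightarrow> real) \<Rightarrow> bool" where
  "is_grid_subcopula n e \<longleftrightarrow>
     (\<forall>i j. (n < i \<or> n < j) \<longrightarrow> e i j = 0) \<and>
     (\<forall>i\<le>n. e i 0 = 0 \<and> e 0 i = 0 \<and> e i n = real i / real n \<and> e n i = real i / real n) \<and>
     (\<forall>i1 i2 j1 j2. i1 \<le> i2 \<longrightarrow> i2 \<le> n \<longrightarrow> j1 \<le> j2 \<longrightarrow> j2 \<le> n \<longrightarrow>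
        e i2 j2 - e i1 j2 - e i2 j1 + e i1 j1 \<ge> 0)"

text \<open>The subcopula E'_n with H_n(x,y) = E'_n(F_n(x), G_n(y)); note n F_n(x) is the number of
  indices i < n with x_i \<le> x.\<close>
definition emp_subcopula :: "(nat \<Rightarrow> real) \<Rightarrow> (nat \<Rightarrow> real) \<Rightarrow> nat \<Rightarrow> nat \<Rightarrow> nat \<Rightarrow> real" where
  "emp_subcopula x y n = (THE e. is_grid_subcopula n e \<and>
     (\<forall>s t. emp_joint_df x y n s t =
        e (card {i. i < n \<and> x i \<le> s}) (card {i. i < n \<and> y i \<le> t})))"

definition bilinear_ext :: "nat \<Rightarrow> (nat \<Rightarrow> nat \<Rightarrow> real) \<Rightarrow> real \<Rightarrow> real \<Rightarrow> real" where
  "bilinear_ext n e u v =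
     (let i = min (nat \<lfloor>real n * u\<rfloor>) (n - 1); j = min (nat \<lfloor>real n * v\<rfloor>) (n - 1);
          a = real n * u - real i; b = real n * v - real j
      in (1 - a) * (1 - b) * e i j + a * (1 - b) * e (Suc i) j
         + (1 - a) * b * e i (Suc j) + a * b * e (Suc i) (Suc j))"

definition emp_copula :: "(nat \<Rightarrow> real) \<Rightarrow> (nat \<Rightarrow> real) \<Rightarrow> nat \<Rightarrow> real \<Rightarrow> real \<Rightarrow> real" where
  "emp_copula x y n = bilinear_ext n (emp_subcopula x y n)"

end

theory Submission
  imports Defs "HOL-Real_Asymp.Real_Asymp"
begin

text \<open>
  Quantile intervals are controlled by monotonicity: if the checkerboard kernels converge to \<open>K\<^sub>H\<close>
  pointwise at rational \<open>y\<close>, the approximating quantile interval eventually lies in every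
  neighbourhood of the limiting one. For pointwise convergence,
  \<open>K\<^bsub>CB(B)\<^esub>(u,[0,v])\<close> is sandwiched between difference quotients
  \<open>N (B(i/N, w) - B((i-1)/N, w))\<close> with \<open>w\<close> within \<open>1/N\<close> of \<open>v\<close>. Replacing the empirical
  copula by \<open>A\<close> costs at most \<open>2 N\<close> times the uniform distance of the two, and the quotient for \<open>A\<close>
  is an average of the continuous kernel near \<open>(u,v)\<close>. Hoeffding's inequality on the grid
  \<open>(k/n, l/n)\<close> for the sample \<open>(F(X\<^sub>i), G(Y\<^sub>i))\<close>, together with Borel-Cantelli, bounds the uniform
  distance by a multiple of \<open>n powr - t\<close> for every \<open>t < 1/2\<close>, which beats
  \<open>N(n) \<le> n powr s\<close> once \<open>s < t\<close>.
\<close>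

section \<open>Copulas, doubly stochastic measures and checkerboard kernels\<close>

text \<open>\<open>dsm\<close> and \<open>emp_subcopula\<close> are definite descriptions, so they
  carry meaning only after existence and uniqueness are settled. Existence comes from explicit
  witnesses: for \<open>A\<close> the law of (F(X), G(Y)), for the empirical copula a density that
  spreads mass 1/n over one small square per observation. The subcopula is unique once (F_n, G_n)
  hits every grid point, which holds for samples without ties; continuity of H provides this almost
  surely. Likewise \<open>Sup\<close> and \<open>Inf\<close> of reals are informative only for
  nonempty bounded sets, so the limiting kernel must both fall below and rise above
  \<open>\<tau>\<close> as y varies. The lower end is delicate: a version of a Markov kernel might
  have an atom at 0 for some x, and joint continuity is what excludes this for every x. The
  exceptional null set depends neither on x nor on y: it collects samples with ties and those
  violating a uniform grid estimate infinitely often.\<close>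

lemma copula_rect_nonneg:
  assumes "is_copula A" "0 \<le> u" "u \<le> u'" "u' \<le> 1" "0 \<le> v" "v \<le> v'" "v' \<le> 1"
  shows "A u' v' - A u v' - A u' v + A u v \<ge> 0"
proof -
  have "u \<in> {0..1}" "u' \<in> {0..1}" "v \<in> {0..1}" "v' \<in> {0..1}" using assms by auto
  then show ?thesis using assms unfolding is_copula_def by blast
qed

lemma copula_mono:
  assumes "is_copula A" "0 \<le> u" "u \<le> u'" "u' \<le> 1" "v \<in> {0..1}"
  shows "A u v \<le> A u' v" "A v u \<le> A v u'"
proof -
  have 1: "A v 0 = 0" "A 0 v = 0" "A u 0 = 0" "A 0 u = 0" "A u' 0 = 0" "A 0 u' = 0"
    using assms by (auto simp: is_copula_def)
  have "A u' v - A u v - A u' 0 + A u 0 \<ge> 0" "A v u' - A 0 u' - A v u + A 0 u \<ge> 0"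
    using copula_rect_nonneg[OF assms(1-4), of 0 v] copula_rect_nonneg[OF assms(1) _ _ _ assms(2-4), of 0 v]
      assms(5) by auto
  with 1 show "A u v \<le> A u' v" "A v u \<le> A v u'" by auto
qed

text \<open>The rectangle between height v and height 1 has nonnegative volume, so the increment at
  v is at most the one at 1, where the margin is uniform.\<close>

lemma copula_lipschitz_aux:
  assumes "is_copula A" "0 \<le> u" "u \<le> u'" "u' \<le> 1" "v \<in> {0..1}"
  shows "A u' v - A u v \<le> u' - u" "A v u' - A v u \<le> u' - u"
proof -
  have 1: "A u 1 = u" "A 1 u = u" "A u' 1 = u'" "A 1 u' = u'"
    using assms by (auto simp: is_copula_def)
  have "A u' 1 - A u 1 - A u' v + A u v \<ge> 0" "A 1 u' - A v u' - A 1 u + A v u \<ge> 0"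
    using copula_rect_nonneg[OF assms(1-4), of v 1] copula_rect_nonneg[OF assms(1) _ _ _ assms(2-4), of v 1]
      assms(5) by auto
  with 1 show "A u' v - A u v \<le> u' - u" "A v u' - A v u \<le> u' - u" by auto
qed

lemma copula_lipschitz:
  assumes A: "is_copula A" and "u \<in> {0..1}" "u' \<in> {0..1}" "v \<in> {0..1}" "v' \<in> {0..1}"
  shows "\<bar>A u v - A u' v'\<bar> \<le> \<bar>u - u'\<bar> + \<bar>v - v'\<bar>"
proof -
  have "\<bar>A u v - A u' v\<bar> \<le> \<bar>u - u'\<bar>"
    using copula_mono(1)[OF A, of u u' v] copula_mono(1)[OF A, of u' u v]
      copula_lipschitz_aux(1)[OF A, of u u' v] copula_lipschitz_aux(1)[OF A, of u' u v] assms
    by (cases "u \<le> u'") auto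
  moreover have "\<bar>A u' v - A u' v'\<bar> \<le> \<bar>v - v'\<bar>"
    using copula_mono(2)[OF A, of v v' u'] copula_mono(2)[OF A, of v' v u']
      copula_lipschitz_aux(2)[OF A, of v v' u'] copula_lipschitz_aux(2)[OF A, of v' v u'] assms
    by (cases "v \<le> v'") auto
  ultimately show ?thesis by linarith
qed

section \<open>Uniqueness of the doubly stochastic measure\<close>

lemma is_dsm_measure_subset_unit:
  assumes "is_dsm B \<mu>" "S \<in> sets borel"
  shows "emeasure \<mu> S = emeasure \<mu> (S \<inter> {0..1} \<times> {0..1})"
proof -
  have s: "sets \<mu> = sets borel" and z: "emeasure \<mu> (UNIV - {0..1} \<times> {0..1}) = 0"
    using assms(1) by (auto simp: is_dsm_def)
  have "emeasure \<mu> (S - {0..1} \<times> {0..1}) \<le> emeasure \<mu> (UNIV - {0..1} \<times> {0..1})"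
    by (intro emeasure_mono) (auto simp: s closed_Times)
  then have "S - {0..1} \<times> {0..1} \<in> null_sets \<mu>"
    using z assms(2) by (auto simp: null_sets_def s closed_Times borel_closed)
  then have "emeasure \<mu> (S - (S - {0..1} \<times> {0..1})) = emeasure \<mu> S"
    using assms(2) s by (intro emeasure_Diff_null_set) auto
  then show ?thesis by (simp add: Diff_Diff_Int)
qed

text \<open>Lower left quadrants form an intersection-stable generator of the Borel sets. Cutting
  one with the unit square leaves nothing or a rectangle anchored at the origin, whose mass
  \<open>is_dsm\<close> prescribes.\<close>

lemma is_dsm_unique:
  assumes \<mu>: "is_dsm B \<mu>" and \<nu>: "is_dsm B \<nu>"
  shows "\<mu> = \<nu>"
proof -
  have s: "sets \<mu> = sets borel" "sets \<nu> = sets borel" and f: "finite_measure \<mu>" "finite_measure \<nu>"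
    using assms by (auto simp: is_dsm_def)
  let ?E = "range (\<lambda>a::real \<times> real. {..a})"
  have gen: "sets (borel :: (real \<times> real) measure) = sigma_sets UNIV ?E"
    by (subst borel_eq_atMost) auto
  have eq: "emeasure \<mu> {..a} = emeasure \<nu> {..a}" for a :: "real \<times> real"
  proof -
    obtain x y where a: "a = (x, y)" by (cases a)
    have int: "{..a} \<inter> {0..1} \<times> {0..1} = (if x < 0 \<or> y < 0 then {} else {0..min x 1} \<times> {0..min y 1})"
      by (auto simp: a)
    have m: "measure \<mu> ({0..min x 1} \<times> {0..min y 1}) = measure \<nu> ({0..min x 1} \<times> {0..min y 1})"
      if "x \<ge> 0" "y \<ge> 0" using assms that unfolding is_dsm_def by auto
    have "emeasure \<mu> ({..a} \<inter> {0..1} \<times> {0..1}) = emeasure \<nu> ({..a} \<inter> {0..1} \<times> {0..1})"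
      unfolding int using m by (auto simp: finite_measure.emeasure_eq_measure[OF f(1)]
          finite_measure.emeasure_eq_measure[OF f(2)] not_less)
    then show ?thesis
      using is_dsm_measure_subset_unit[OF \<mu>, of "{..a}"] is_dsm_measure_subset_unit[OF \<nu>, of "{..a}"]
      by auto
  qed
  show ?thesis
  \<comment> \<open>The quadrants with corner (i, i) have finite mass and exhaust the plane, as the
    uniqueness theorem demands.\<close>
  proof (rule measure_eqI_generator_eq[where E = ?E and \<Omega> = UNIV and A = "\<lambda>n::nat. {..(real n, real n)}"])
    have "{..(a, b)} \<inter> {..(c, d)} = {..(min a c, min b d)}" for a b c d :: real
      by auto
    then show "Int_stable ?E"
      by (auto simp: Int_stable_def)
    show "(\<Union>i. {..(real i, real i)}) = UNIV"
    proof -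
      have "\<exists>n. a \<le> real n \<and> b \<le> real n" for a b
        using real_arch_simple[of "max a b"] by auto
      then show ?thesis by (auto simp: less_eq_prod_def)
    qed
    show "emeasure \<mu> {..(real i, real i)} \<noteq> \<infinity>" for i
      using f(1) by (simp add: finite_measure.emeasure_eq_measure)
  qed (use gen s eq in auto)
qed

text \<open>Evaluates the definite description: it suffices to exhibit one measure with the required
  rectangle masses.\<close>

lemma dsm_eq: "is_dsm B \<mu> \<Longrightarrow> dsm B = \<mu>"
  unfolding dsm_def using is_dsm_unique by blast

section \<open>Checkerboard cells and the sandwich for the checkerboard kernel\<close>

lemma cb_I_props:
  assumes "1 \<le> i" "i \<le> N"
  shows "cb_I N i \<subseteq> {0..1}" "cb_I N i \<in> sets borel" "measure lborel (cb_I N i) = 1 / N"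
    "emeasure lborel (cb_I N i) = ennreal (1 / N)"
    "\<And>t. t \<in> cb_I N i \<Longrightarrow> (real i - 1) / N \<le> t \<and> t \<le> real i / N"
proof -
  have N: "real N > 0" "real i \<le> real N" "real i \<ge> 1" using assms by auto
  have 2: "(real i - 1) / N \<le> real i / N" using N by (simp add: divide_right_mono)
  have 3: "0 \<le> (real i - 1) / N" "real i / N \<le> 1" using N by auto
  show 1: "\<And>t. t \<in> cb_I N i \<Longrightarrow> (real i - 1) / N \<le> t \<and> t \<le> real i / N"
    using assms by (auto simp: cb_I_def split: if_splits)
  show "cb_I N i \<subseteq> {0..1}" using 1 3 by force
  show "cb_I N i \<in> sets borel" by (auto simp: cb_I_def)
  have 4: "real i / N - (real i - 1) / N = 1 / N" using N by (simp add: field_simps)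
  show "measure lborel (cb_I N i) = 1 / N" "emeasure lborel (cb_I N i) = ennreal (1 / N)" 
    using 2 4 by (auto simp: cb_I_def)
qed

lemma is_dsm_measure_strip:
  assumes \<mu>: "is_dsm B \<mu>" and B0: "\<And>v. v \<in> {0..1} \<Longrightarrow> B 0 v = 0"
    and i: "1 \<le> i" "i \<le> N" and v: "v \<in> {0..1}"
  shows "measure \<mu> (cb_I N i \<times> {0..v}) = B (real i / N) v - B ((real i - 1) / N) v"
proof -
  have s: "sets \<mu> = sets borel" and f: "finite_measure \<mu>"
    and m: "\<And>x y. x \<in> {0..1} \<Longrightarrow> y \<in> {0..1} \<Longrightarrow> measure \<mu> ({0..x} \<times> {0..y}) = B x y"
    using \<mu> by (auto simp: is_dsm_def)
  have N: "real N > 0" "real i \<le> real N" "real i \<ge> 1" using i by auto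
  have u: "real i / N \<in> {0..1}" "(real i - 1) / N \<in> {0..1}" "(real i - 1) / N \<le> real i / N"
    using N by (auto simp: divide_simps)
  show ?thesis
  \<comment> \<open>The first cell contains its left end point 0, so it is not a difference of two
    anchored intervals; \<open>B 0 v = 0\<close> supplies the missing term.\<close>
  proof (cases "i = 1")
    case True
    then show ?thesis using m[OF u(1) v] B0[OF v] by (simp add: cb_I_def)
  next
    case False
    then have "cb_I N i \<times> {0..v} = {0..real i / N} \<times> {0..v} - {0..(real i - 1) / N} \<times> {0..v}"
      using u by (auto simp: cb_I_def)
    then have "measure \<mu> (cb_I N i \<times> {0..v}) =
        measure \<mu> ({0..real i / N} \<times> {0..v}) - measure \<mu> ({0..(real i - 1) / N} \<times> {0..v})"
      using u(3) by (auto intro!: finite_measure.finite_measure_Diff f simp: s closed_Times borel_closed)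
    then show ?thesis using m u v by simp
  qed
qed

lemma cb_I_disjoint:
  assumes "1 \<le> i" "1 \<le> j" "i \<noteq> j"
  shows "cb_I N i \<inter> cb_I N j = {}"
proof -
  have *: "cb_I N i \<inter> cb_I N j = {}" if "1 \<le> i" "i < j" for i j
  \<comment> \<open>For \<open>N = 0\<close> division by zero gives 0, so every cell beyond the
    first is empty.\<close>
  proof (cases "N = 0")
    case False
    have "\<not> (real j - 1) / N < t" if "t \<le> real i / N" for t
    proof -
      have "real i / N \<le> (real j - 1) / N" using \<open>i < j\<close> False by (intro divide_right_mono) auto
      with that show ?thesis by linarith
    qed
    with that False show ?thesis by (force simp: cb_I_def split: if_splits)
  qed (use that in \<open>auto simp: cb_I_def\<close>)
  show ?thesis using assms *[of i j] *[of j i] by (cases "i < j") auto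
qed

lemma cb_I_cover:
  assumes "N \<ge> 1"
  shows "1 \<le> m \<Longrightarrow> (\<Union>j\<in>{1..m}. cb_I N j) = {0..real m / N}"
proof (induction m rule: nat_induct_at_least)
  case base
  then show ?case by (simp add: cb_I_def)
next
  case (Suc n)
  have "{1..Suc n} = insert (Suc n) {1..n}" by auto
  then have "(\<Union>j\<in>{1..Suc n}. cb_I N j) = cb_I N (Suc n) \<union> {0..real n / N}"
    using Suc by (simp del: of_nat_Suc)
  also have "\<dots> = {0..real (Suc n) / N}"
  proof -
    have "real n / N \<le> real (Suc n) / N" "0 \<le> real n / N" by (auto simp: divide_right_mono)
    moreover have "0 \<le> x" if "real n / N < x" for x
      by (rule order.trans[OF _ less_imp_le[OF that]]) simp
    ultimately show ?thesis using Suc.hyps by (auto simp: cb_I_def)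
  qed
  finally show ?case .
qed

lemma measure_strip_eq_sum:
  assumes \<mu>: "is_dsm B \<mu>" and N: "N \<ge> 1" and m: "1 \<le> m" and i: "1 \<le> i" "i \<le> N"
  shows "measure \<mu> (cb_I N i \<times> {0..real m / N}) = (\<Sum>j\<in>{1..m}. measure \<mu> (cb_Q N i j))"
proof -
  have s: "sets \<mu> = sets borel" and f: "finite_measure \<mu>"
    using \<mu> by (auto simp: is_dsm_def)
  have "cb_I N i \<times> {0..real m / N} = (\<Union>j\<in>{1..m}. cb_Q N i j)"
    using cb_I_cover[OF N m] by (auto simp: cb_Q_def)
  also have "measure \<mu> \<dots> = (\<Sum>j\<in>{1..m}. measure \<mu> (cb_Q N i j))"
  proof (rule finite_measure.finite_measure_finite_Union[OF f])
    show "disjoint_family_on (cb_Q N i) {1..m}"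
      using cb_I_disjoint by (fastforce simp: disjoint_family_on_def cb_Q_def)
    have "cb_I N j \<in> sets borel" for j by (auto simp: cb_I_def)
    then have "cb_Q N i j \<in> sets borel" for j
      unfolding cb_Q_def borel_prod[symmetric] by (intro pair_measureI) auto
    then show "cb_Q N i ` {1..m} \<subseteq> sets \<mu>"
      by (auto simp: s)
  qed auto
  finally show ?thesis .
qed

lemma cb_kernel_eq:
  assumes "u \<in> cb_I N i" "1 \<le> i" "i \<le> N"
  shows "cb_kernel N B u v = (real N)\<^sup>2 * (\<Sum>j\<in>{1..N}. measure (dsm B) (cb_Q N i j) *
           measure lborel ({0..v} \<inter> cb_I N j))"
proof -
  have "indicator (cb_I N i') u = (if i' = i then 1 else 0 :: real)" if "i' \<in> {1..N}" for i'
    using that assms cb_I_disjoint[of i i' N] by (auto simp: indicator_def)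
  then have "(\<Sum>i'\<in>{1..N}. \<Sum>j\<in>{1..N}. measure (dsm B) (cb_Q N i' j) * indicator (cb_I N i') u *
        measure lborel ({0..v} \<inter> cb_I N j)) =
     (\<Sum>i'\<in>{1..N}. if i' = i then \<Sum>j\<in>{1..N}. measure (dsm B) (cb_Q N i' j) *
        measure lborel ({0..v} \<inter> cb_I N j) else 0)"
    by (intro sum.cong) auto
  then show ?thesis using assms by (simp add: cb_kernel_def)
qed

lemma measure_Int_cb_I_le:
  assumes "1 \<le> j" "j \<le> N"
  shows "measure lborel ({0..v} \<inter> cb_I N j) \<le> 1 / N"
proof -
  have "measure lborel ({0..v} \<inter> cb_I N j) \<le> measure lborel (cb_I N j)"
    using cb_I_props[OF assms] by (intro measure_mono_fmeasurable) (auto simp: fmeasurable_def)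
  then show ?thesis using cb_I_props[OF assms] by simp
qed

lemma cb_kernel_mono:
  assumes "v \<le> v'"
  shows "cb_kernel N B u v \<le> cb_kernel N B u v'"
proof -
  have "measure lborel ({0..v} \<inter> cb_I N j) \<le> measure lborel ({0..v'} \<inter> cb_I N j)" if "j \<in> {1..N}" for j
  proof (rule measure_mono_fmeasurable)
    have "emeasure lborel ({0..v'} \<inter> cb_I N j) \<le> emeasure lborel (cb_I N j)"
      using cb_I_props[of j N] that by (intro emeasure_mono) auto
    then show "{0..v'} \<inter> cb_I N j \<in> fmeasurable lborel"
      using cb_I_props[of j N] that by (auto simp: fmeasurable_def intro: le_less_trans)
  qed (use assms cb_I_props[of j N] that in auto)
  then show ?thesis
    unfolding cb_kernel_def
    by (intro mult_left_mono sum_mono) (auto intro!: mult_nonneg_nonneg)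
qed

text \<open>The kernel weights each square of column i by the fraction of its height lying below v.
  Only one square can be covered partially: discarding it gives the lower bound, counting it fully
  gives the upper bound, and both leave a strip whose height is a multiple of 1/N.\<close>

lemma cb_kernel_bounds:
  assumes \<mu>: "is_dsm B \<mu>" and i: "u \<in> cb_I N i" "1 \<le> i" "i \<le> N" and v: "v \<in> {0..1}"
    and B0: "\<And>u. u \<in> {0..1} \<Longrightarrow> B u 0 = 0" "\<And>v. v \<in> {0..1} \<Longrightarrow> B 0 v = 0"
  obtains w w' where "w \<in> {0..1}" "\<bar>w - v\<bar> \<le> 1 / N" "w' \<in> {0..1}" "\<bar>w' - v\<bar> \<le> 1 / N"
    "N * measure \<mu> (cb_I N i \<times> {0..w}) \<le> cb_kernel N B u v"
    "cb_kernel N B u v \<le> N * measure \<mu> (cb_I N i \<times> {0..w'})"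
proof -
  have N: "N \<ge> 1" "real N > 0" using i by auto
  \<comment> \<open>The number of cells lying entirely below v.\<close>
  define k where "k = nat \<lfloor>N * v\<rfloor>"
  have "0 \<le> N * v" "N * v \<le> N" using v N by (auto simp: mult_le_cancel_left2)
  then have k: "real k \<le> N * v" "N * v < real k + 1" "k \<le> N"
    by (auto simp: k_def, linarith+)
  \<comment> \<open>The cap matters for v = 1, where all N cells are full and no partial one
    follows.\<close>
  define k' where "k' = min (k + 1) N"
  have k': "k' \<ge> 1" "k' \<le> N" using N by (auto simp: k'_def)
  let ?l = "\<lambda>j. measure lborel ({0..v} \<inter> cb_I N j)" and ?q = "\<lambda>j. measure \<mu> (cb_Q N i j)"
  have eq: "cb_kernel N B u v = (real N)\<^sup>2 * (\<Sum>j\<in>{1..N}. ?q j * ?l j)"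
    using cb_kernel_eq[OF i] dsm_eq[OF \<mu>] by simp
  have "(\<Sum>j\<in>{1..k}. ?q j * (1 / N)) = (\<Sum>j\<in>{1..k}. ?q j * ?l j)"
  proof (intro sum.cong refl)
    fix j assume j: "j \<in> {1..k}"
    then have j': "1 \<le> j" "j \<le> N" using k by auto
    have "real j / N \<le> v" using j k N by (auto simp: field_simps intro: order_trans)
    then have "{0..v} \<inter> cb_I N j = cb_I N j" using cb_I_props(1,5)[OF j'] by force
    then show "?q j * (1 / N) = ?q j * ?l j" using cb_I_props(3)[OF j'] by simp
  qed
  also have "\<dots> \<le> (\<Sum>j\<in>{1..N}. ?q j * ?l j)"
    using k by (intro sum_mono2) auto
  finally have "(real N)\<^sup>2 * (\<Sum>j\<in>{1..k}. ?q j * (1 / N)) \<le> cb_kernel N B u v"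
    unfolding eq by (rule mult_left_mono) auto
  then have 1: "N * (\<Sum>j\<in>{1..k}. ?q j) \<le> cb_kernel N B u v"
    using N by (simp add: sum_distrib_right[symmetric] sum_divide_distrib[symmetric] power2_eq_square)
  have "measure \<mu> (cb_I N i \<times> {0..real k / N}) = (\<Sum>j\<in>{1..k}. ?q j)"
  \<comment> \<open>The strip degenerates to height 0 and is massless by \<open>B u 0 = 0\<close>,
    matching the empty sum.\<close>
  proof (cases "k = 0")
    case True
    have "(real i - 1) / N \<in> {0..1}" "real i / N \<in> {0..1}" using i by (auto simp: field_simps)
    then show ?thesis using True is_dsm_measure_strip[OF \<mu> B0(2) i(2,3), of 0] B0(1) by simp
  next
    case False
    then show ?thesis using measure_strip_eq_sum[OF \<mu> N(1) _ i(2,3)] by simp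
  qed
  with 1 have L: "N * measure \<mu> (cb_I N i \<times> {0..real k / N}) \<le> cb_kernel N B u v" by simp
  have "(\<Sum>j\<in>{1..N}. ?q j * ?l j) = (\<Sum>j\<in>{1..k'}. ?q j * ?l j)"
  proof (rule sum.mono_neutral_right)
    show "\<forall>j\<in>{1..N} - {1..k'}. ?q j * ?l j = 0"
    proof
      fix j assume "j \<in> {1..N} - {1..k'}"
      then have j: "j \<noteq> 1" "k + 1 < j \<or> k + 1 \<le> j \<and> N < j" "j \<le> N" by (auto simp: k'_def min_def split: if_splits)
      then have "v \<le> (real j - 1) / N" using k N by (auto simp: field_simps)
      \<comment> \<open>Cells after the first are open on the left, so equality of v with the lower
        end still gives an empty intersection.\<close>
      then have "{0..v} \<inter> cb_I N j = {}" using j by (auto simp: cb_I_def)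
      then show "?q j * ?l j = 0" by simp
    qed
  qed (use k' in auto)
  also have "\<dots> \<le> (\<Sum>j\<in>{1..k'}. ?q j * (1 / N))"
    using k' measure_Int_cb_I_le by (intro sum_mono mult_left_mono) auto
  finally have "cb_kernel N B u v \<le> (real N)\<^sup>2 * (\<Sum>j\<in>{1..k'}. ?q j * (1 / N))"
    unfolding eq by (rule mult_left_mono) auto
  then have "cb_kernel N B u v \<le> N * (\<Sum>j\<in>{1..k'}. ?q j)"
    using N by (simp add: sum_distrib_right[symmetric] sum_divide_distrib[symmetric] power2_eq_square)
  then have U: "cb_kernel N B u v \<le> N * measure \<mu> (cb_I N i \<times> {0..real k' / N})"
    using measure_strip_eq_sum[OF \<mu> N(1) k'(1) i(2,3)] by simp
  have "real k / N \<in> {0..1}" "real k' / N \<in> {0..1}" using k k' N by (auto simp: field_simps)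
  moreover have "\<bar>real k / N - v\<bar> \<le> 1 / N"
  proof -
    have "real k / N \<le> v" "v \<le> (real k + 1) / N"
      using k N by (auto simp: pos_divide_le_eq pos_le_divide_eq mult.commute)
    then show ?thesis by (simp add: add_divide_distrib abs_le_iff)
  qed
  moreover have "\<bar>real k' / N - v\<bar> \<le> 1 / N"
  proof -
    have "real k' \<ge> N * v" "real k' \<le> N * v + 1" using k \<open>N * v \<le> N\<close> by (auto simp: k'_def min_def)
    then have "real k' / N \<ge> v" "real k' / N \<le> (N * v + 1) / N"
      using N by (auto simp: pos_divide_le_eq pos_le_divide_eq mult.commute)
    then show ?thesis using N by (simp add: add_divide_distrib abs_le_iff)
  qed
  ultimately show ?thesis using that L U by blast
qed

section \<open>Continuous Markov kernels and quantile intervals\<close>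

lemma markov_kernel_strip_bounds:
  assumes K: "is_markov_kernel A K" and S: "S \<in> sets borel" "S \<subseteq> {0..1}" and v: "v \<in> {0..1}"
    and b: "\<And>t. t \<in> S \<Longrightarrow> l \<le> measure (K t) {0..v} \<and> measure (K t) {0..v} \<le> h"
  shows "l * measure lborel S \<le> measure (dsm A) (S \<times> {0..v})"
    "measure (dsm A) (S \<times> {0..v}) \<le> h * measure lborel S"
proof -
  let ?k = "\<lambda>t. measure (K t) {0..v}"
  have fin: "emeasure lborel S < \<infinity>"
  proof -
    have "emeasure lborel S \<le> emeasure lborel {0..1::real}"
      using S by (intro emeasure_mono) auto
    then show ?thesis by (simp add: le_less_trans[OF _ ennreal_one_less_top])
  qed
  have const: "set_integrable lborel S (\<lambda>_. c::real)" for c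
    using fin S unfolding set_integrable_def by simp
  have cint: "(LINT t:S|lborel. c) = c * measure lborel S" for c :: real
    using S by (simp add: set_lebesgue_integral_def)
  \<comment> \<open>The kernel is measurable only on [0,1]; the indicator extends this to the whole
    line, where \<open>lborel\<close> integrates.\<close>
  have meas: "(\<lambda>t. indicator {0..1} t *\<^sub>R ?k t) \<in> borel_measurable borel"
    using K by (subst borel_measurable_restrict_space_iff[symmetric]) (auto simp: is_markov_kernel_def)
  have int: "set_integrable lborel S ?k"
    unfolding set_integrable_def
  proof (rule Bochner_Integration.integrable_bound)
    show "integrable lborel (\<lambda>t. indicator S t *\<^sub>R (1::real))"
      using const[of 1] unfolding set_integrable_def .
    have "(\<lambda>t. indicator S t *\<^sub>R (indicator {0..1} t *\<^sub>R ?k t)) \<in> borel_measurable borel"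
      by (rule borel_measurable_scaleR[OF _ meas]) (use S in auto)
    also have "(\<lambda>t. indicator S t *\<^sub>R (indicator {0..1} t *\<^sub>R ?k t)) = (\<lambda>t. indicator S t *\<^sub>R ?k t)"
      using S by (auto simp: indicator_def fun_eq_iff)
    finally show "(\<lambda>t. indicator S t *\<^sub>R ?k t) \<in> borel_measurable lborel" by simp
    have "?k t \<le> 1" if "t \<in> S" for t
      using K S that by (intro prob_space.prob_le_1) (auto simp: is_markov_kernel_def)
    then show "AE t in lborel. norm (indicator S t *\<^sub>R ?k t) \<le> norm (indicator S t *\<^sub>R (1::real))"
      by (intro AE_I2) (auto simp: indicator_def)
  qed
  have "{0..v} \<subseteq> {0..1}" using v by auto
  then have eq: "(LINT t:S|lborel. ?k t) = measure (dsm A) (S \<times> {0..v})"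
    using K S unfolding is_markov_kernel_def by auto
  show "l * measure lborel S \<le> measure (dsm A) (S \<times> {0..v})"
    unfolding eq[symmetric] cint[symmetric] using b by (intro set_integral_mono const int) auto
  show "measure (dsm A) (S \<times> {0..v}) \<le> h * measure lborel S"
    unfolding eq[symmetric] cint[symmetric] using b by (intro set_integral_mono const int) auto
qed

lemma kernel_near:
  assumes K: "is_continuous_markov_kernel A K" and u: "u \<in> {0..1}" and v: "v \<in> {0..1}" and e: "e > 0"
  obtains d where "d > 0" "\<And>t w. t \<in> {0..1} \<Longrightarrow> w \<in> {0..1} \<Longrightarrow> \<bar>t - u\<bar> < d \<Longrightarrow> \<bar>w - v\<bar> < d \<Longrightarrow>
     \<bar>measure (K t) {0..w} - measure (K u) {0..v}\<bar> < e"
proof -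
  have c: "continuous_on ({0..1} \<times> {0..1}) (\<lambda>(x, y). measure (K x) {0..y})"
    using K by (simp add: is_continuous_markov_kernel_def)
  obtain d where d: "d > 0" "\<forall>p\<in>{0..1} \<times> {0..1}. dist p (u, v) < d \<longrightarrow>
      dist (case p of (x, y) \<Rightarrow> measure (K x) {0..y}) (measure (K u) {0..v}) < e"
    using c[unfolded continuous_on_iff, rule_format, of "(u, v)" e] u v e by auto
  show ?thesis
  \<comment> \<open>Halving the radius replaces the Euclidean ball by separate bounds on the two
    coordinates.\<close>
  proof (rule that[of "d / 2"])
    fix t w assume t: "t \<in> {0..1}" "w \<in> {0..1}" "\<bar>t - u\<bar> < d / 2" "\<bar>w - v\<bar> < d / 2"
    have "dist (t, w) (u, v) \<le> \<bar>t - u\<bar> + \<bar>w - v\<bar>"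
      unfolding dist_Pair_Pair dist_real_def using sqrt_sum_squares_le_sum_abs by auto
    then have "dist (t, w) (u, v) < d" using t by linarith
    then show "\<bar>measure (K t) {0..w} - measure (K u) {0..v}\<bar> < e"
      using d(2)[rule_format, of "(t, w)"] t by (auto simp: dist_real_def)
  qed (use d in auto)
qed

text \<open>An atom at 0 would persist, with at least half its size, for all first arguments near u.
  Integrating over such a neighbourhood would give the bottom edge of the unit square positive mass,
  yet its mass is \<open>A 1 0 = 0\<close>.\<close>

lemma continuous_markov_kernel_at_0:
  assumes A: "is_copula A" and \<nu>: "is_dsm A \<nu>" and K: "is_continuous_markov_kernel A K"
    and u: "u \<in> {0..1}"
  shows "measure (K u) {0..0} = 0"
proof (rule ccontr)
  assume "measure (K u) {0..0} \<noteq> 0"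
  then have c: "measure (K u) {0..0} > 0" by (simp add: order_less_le)
  define c where "c = measure (K u) {0..0}"
  obtain d where d: "d > 0" "\<And>t w. t \<in> {0..1} \<Longrightarrow> w \<in> {0..1} \<Longrightarrow> \<bar>t - u\<bar> < d \<Longrightarrow> \<bar>w - 0\<bar> < d \<Longrightarrow>
     \<bar>measure (K t) {0..w} - measure (K u) {0..0}\<bar> < c / 2"
    using kernel_near[OF K u, of 0 "c / 2"] c by (auto simp: c_def)
  \<comment> \<open>Clipping keeps \<open>S\<close> inside the unit interval; its length stays
    positive even when u is an end point.\<close>
  define S where "S = {max 0 (u - d / 2)..min 1 (u + d / 2)}"
  have S: "measure lborel S > 0" using d(1) u by (auto simp: S_def)
  have Ssub: "S \<subseteq> {0..1}" by (auto simp: S_def)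
  have K': "is_markov_kernel A K" using K by (simp add: is_continuous_markov_kernel_def)
  have "c / 2 * measure lborel S \<le> measure (dsm A) (S \<times> {0..0})"
  proof (rule markov_kernel_strip_bounds(1)[OF K'])
    fix t assume "t \<in> S"
    then have t: "t \<in> {0..1}" "\<bar>t - u\<bar> < d" using d(1) by (auto simp: S_def abs_less_iff)
    have "measure (K t) {0..0} \<le> 1"
      using K' t by (intro prob_space.prob_le_1) (auto simp: is_markov_kernel_def)
    moreover have "c / 2 \<le> measure (K t) {0..0}"
    proof -
      have "\<bar>measure (K t) {0..0} - measure (K u) {0..0}\<bar> < c / 2"
        by (rule d(2)) (use t d(1) in auto)
      then show ?thesis unfolding c_def by linarith
    qed
    ultimately show "c / 2 \<le> measure (K t) {0..0} \<and> measure (K t) {0..0} \<le> 1" by simp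
  qed (use Ssub in \<open>auto simp: S_def\<close>)
  also have "\<dots> = measure \<nu> (S \<times> {0..0})" using dsm_eq[OF \<nu>] by simp
  also have "\<dots> \<le> measure \<nu> ({0..1} \<times> {0..0})"
    using \<nu> Ssub by (intro finite_measure.finite_measure_mono) (auto simp: is_dsm_def borel_closed closed_Times)
  also have "\<dots> = A 1 0"
  proof -
    have "(1::real) \<in> {0..1}" "(0::real) \<in> {0..1}" by auto
    then show ?thesis using \<nu> unfolding is_dsm_def by blast
  qed
  also have "\<dots> = 0" using A unfolding is_copula_def by auto
  finally show False using c S by (simp add: c_def mult_le_0_iff)
qed

lemma ex_cb_I:
  assumes "N \<ge> 1" "u \<in> {0..1}"
  obtains i where "1 \<le> i" "i \<le> N" "u \<in> cb_I N i"
proof -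
  have "(\<Union>j\<in>{1..N}. cb_I N j) = {0..1}" using cb_I_cover[of N N] assms by simp
  then have "u \<in> (\<Union>j\<in>{1..N}. cb_I N j)" using assms by simp
  then show ?thesis using that by auto
qed

text \<open>The deterministic core. The arguments \<open>u n\<close> and \<open>v n\<close> move
  because the estimator is evaluated at F_n(x) and G_n(y). Continuity of the limit kernel absorbs
  this movement and the cell width, while \<open>N\<delta>\<close> controls the copula error
  amplified by the difference quotient.\<close>

lemma cb_kernel_tendsto:
  fixes N :: "nat \<Rightarrow> nat" and \<mu> :: "nat \<Rightarrow> (real \<times> real) measure" and u v \<delta> :: "nat \<Rightarrow> real"
  assumes \<nu>: "is_dsm A \<nu>" and A: "is_copula A" and K: "is_continuous_markov_kernel A K"
    and u0: "u0 \<in> {0..1}" and v0: "v0 \<in> {0..1}"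
    and dsm: "\<forall>\<^sub>F n in sequentially. is_dsm (B n) (\<mu> n)"
    and B0: "\<forall>\<^sub>F n in sequentially. \<forall>a\<in>{0..1}. B n a 0 = 0 \<and> B n 0 a = 0"
    and close: "\<forall>\<^sub>F n in sequentially. \<forall>a\<in>{0..1}. \<forall>b\<in>{0..1}. \<bar>B n a b - A a b\<bar> \<le> \<delta> n"
    and N: "filterlim N at_top sequentially" and N\<delta>: "(\<lambda>n. N n * \<delta> n) \<longlonglongrightarrow> 0"
    and u: "\<forall>\<^sub>F n in sequentially. u n \<in> {0..1}" "u \<longlonglongrightarrow> u0"
    and v: "\<forall>\<^sub>F n in sequentially. v n \<in> {0..1}" "v \<longlonglongrightarrow> v0"
  shows "(\<lambda>n. cb_kernel (N n) (B n) (u n) (v n)) \<longlonglongrightarrow> measure (K u0) {0..v0}"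
proof (rule tendstoI)
  fix e :: real assume e: "e > 0"
  let ?k = "\<lambda>t w. measure (K t) {0..w}"
  obtain d where d: "d > 0" "\<And>t w. t \<in> {0..1} \<Longrightarrow> w \<in> {0..1} \<Longrightarrow> \<bar>t - u0\<bar> < d \<Longrightarrow> \<bar>w - v0\<bar> < d \<Longrightarrow>
     \<bar>?k t w - ?k u0 v0\<bar> < e / 2"
    using kernel_near[OF K u0 v0, of "e / 2"] e by auto
  have "(\<lambda>n. 1 / real (N n)) \<longlonglongrightarrow> 0"
    using N by (intro real_tendsto_divide_at_top[OF tendsto_const] filterlim_compose[OF filterlim_real_sequentially])
  then have e1: "\<forall>\<^sub>F n in sequentially. 1 / real (N n) < d / 2"
    using d(1) by (auto dest!: order_tendstoD(2)[of _ _ _ "d / 2"])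
  have e2: "\<forall>\<^sub>F n in sequentially. N n \<ge> 1" using N by (simp add: filterlim_at_top)
  have e3: "\<forall>\<^sub>F n in sequentially. \<bar>u n - u0\<bar> < d / 2" "\<forall>\<^sub>F n in sequentially. \<bar>v n - v0\<bar> < d / 2"
    using tendstoD[OF u(2), of "d / 2"] tendstoD[OF v(2), of "d / 2"] d(1) by (auto simp: dist_real_def)
  \<comment> \<open>The copula error enters at both ends of the cell, so e/4 here uses up e/2 in
    total and leaves e/2 for the oscillation of the kernel.\<close>
  have e4: "\<forall>\<^sub>F n in sequentially. \<bar>N n * \<delta> n\<bar> < e / 4"
    using tendstoD[OF N\<delta>, of "e / 4"] e by (auto simp: dist_real_def)
  show "\<forall>\<^sub>F n in sequentially. dist (cb_kernel (N n) (B n) (u n) (v n)) (?k u0 v0) < e"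
    using e1 e2 e3 e4 u(1) v(1) dsm B0 close
  proof eventually_elim
    case (elim n)
    obtain i where i: "1 \<le> i" "i \<le> N n" "u n \<in> cb_I (N n) i" using ex_cb_I elim by blast
    let ?I = "cb_I (N n) i" and ?N = "real (N n)"
    have Np: "?N > 0" using elim by simp
    have iN: "real i / ?N \<in> {0..1}" "(real i - 1) / ?N \<in> {0..1}" using i by (auto simp: field_simps)
    obtain w w' where w: "w \<in> {0..1}" "\<bar>w - v n\<bar> \<le> 1 / ?N" "w' \<in> {0..1}" "\<bar>w' - v n\<bar> \<le> 1 / ?N"
      "?N * measure (\<mu> n) (?I \<times> {0..w}) \<le> cb_kernel (N n) (B n) (u n) (v n)"
      "cb_kernel (N n) (B n) (u n) (v n) \<le> ?N * measure (\<mu> n) (?I \<times> {0..w'})"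
      using cb_kernel_bounds[OF elim(8) i(3,1,2) elim(7)] elim(9) by blast
    have A0: "A 0 a = 0" if "a \<in> {0..1}" for a using A that by (auto simp: is_copula_def)
    have main: "\<bar>?N * measure (\<mu> n) (?I \<times> {0..b}) - ?k u0 v0\<bar> < e"
      if b: "b \<in> {0..1}" "\<bar>b - v n\<bar> \<le> 1 / ?N" for b
    proof -
      have mB: "measure (\<mu> n) (?I \<times> {0..b}) = B n (real i / ?N) b - B n ((real i - 1) / ?N) b"
        using is_dsm_measure_strip[OF elim(8) _ i(1,2) b(1)] elim(9) by blast
      have mA: "measure (dsm A) (?I \<times> {0..b}) = A (real i / ?N) b - A ((real i - 1) / ?N) b"
        using is_dsm_measure_strip[OF \<nu> A0 i(1,2) b(1)] dsm_eq[OF \<nu>] by simp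
      have "\<bar>measure (\<mu> n) (?I \<times> {0..b}) - measure (dsm A) (?I \<times> {0..b})\<bar> \<le> 2 * \<delta> n"
        using elim(10)[rule_format, OF iN(1) b(1)] elim(10)[rule_format, OF iN(2) b(1)] unfolding mA mB by linarith
      then have "\<bar>?N * (measure (\<mu> n) (?I \<times> {0..b}) - measure (dsm A) (?I \<times> {0..b}))\<bar> \<le> ?N * (2 * \<delta> n)"
        unfolding abs_mult using Np by (intro mult_mono) auto
      then have 1: "\<bar>?N * measure (\<mu> n) (?I \<times> {0..b}) - ?N * measure (dsm A) (?I \<times> {0..b})\<bar> < e / 2"
        using elim(5) unfolding right_diff_distrib by linarith
      have K': "is_markov_kernel A K" using K by (simp add: is_continuous_markov_kernel_def)
      have near: "?k u0 v0 - e / 2 \<le> ?k t b \<and> ?k t b \<le> ?k u0 v0 + e / 2" if t: "t \<in> ?I" for t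
      proof -
        have "t \<in> {0..1}" using cb_I_props(1)[OF i(1,2)] t by auto
        moreover have "\<bar>t - u n\<bar> \<le> 1 / ?N"
        proof -
          have "real i / ?N = (real i - 1) / ?N + 1 / ?N" by (simp add: diff_divide_distrib)
          then show ?thesis using cb_I_props(5)[OF i(1,2) t] cb_I_props(5)[OF i(1,2) i(3)] by linarith
        qed
        \<comment> \<open>One half of d pays for the cell width, the other for the distance of
          \<open>u n\<close> from \<open>u0\<close>.\<close>
        then have "\<bar>t - u0\<bar> < d" using elim(1,3) by linarith
        moreover have "\<bar>b - v0\<bar> < d" using elim(1,4) b(2) by linarith
        ultimately have "\<bar>?k t b - ?k u0 v0\<bar> < e / 2" using d(2) b(1) by blast
        then show ?thesis by linarith
      qed
      have "(?k u0 v0 - e / 2) * (1 / ?N) \<le> measure (dsm A) (?I \<times> {0..b})"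
        "measure (dsm A) (?I \<times> {0..b}) \<le> (?k u0 v0 + e / 2) * (1 / ?N)"
        using markov_kernel_strip_bounds[OF K' cb_I_props(2,1)[OF i(1,2)] b(1) near] cb_I_props(3)[OF i(1,2)]
        by simp_all
      then have "?k u0 v0 - e / 2 \<le> ?N * measure (dsm A) (?I \<times> {0..b})"
        "?N * measure (dsm A) (?I \<times> {0..b}) \<le> ?k u0 v0 + e / 2"
        using Np by (simp_all add: pos_divide_le_eq pos_le_divide_eq mult.commute)
      then show ?thesis using 1 by linarith
    qed
    show ?case using main[OF w(1,2)] main[OF w(3,4)] w(5,6) by (auto simp: dist_real_def)
  qed
qed

text \<open>Just outside the limiting interval the strict inequalities \<open>k a < \<tau>\<close>
  and \<open>k b > \<tau>\<close> hold, and strict inequalities survive pointwise convergence. By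
  monotonicity the approximating interval is then trapped in [a, b]. The distance is one-sided: the
  approximating interval may stay much shorter than the limiting one.\<close>

lemma quantile_interval_tendsto:
  fixes k :: "real \<Rightarrow> real" and kn :: "nat \<Rightarrow> real \<Rightarrow> real"
  assumes mono: "mono k" "\<And>n. mono (kn n)"
    and low: "\<exists>y. k y < \<tau>" and high: "\<exists>y. k y > \<tau>"
    and lim: "\<And>y. y \<in> \<rat> \<Longrightarrow> (\<lambda>n. kn n y) \<longlonglongrightarrow> k y"
  shows "(\<lambda>n. SUP z \<in> {Sup {y. kn n y < \<tau>}..Inf {y. kn n y > \<tau>}}.
            INF y \<in> {Sup {y. k y < \<tau>}..Inf {y. k y > \<tau>}}. \<bar>z - y\<bar>) \<longlonglongrightarrow> 0"
proof (rule tendstoI)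
  fix e :: real assume e: "e > 0"
  define ql where "ql = Sup {y. k y < \<tau>}"
  define qu where "qu = Inf {y. k y > \<tau>}"
  have sep: "a < b" if "f a < \<tau>" "f b > \<tau>" "mono f" for a b and f :: "real \<Rightarrow> real"
    using that monoD[OF that(3), of b a] by (meson le_less_trans less_asym' not_less order_less_le_trans)
  \<comment> \<open>A value on the opposite side of \<open>\<tau>\<close> bounds each level set, so
    that \<open>Sup\<close> and \<open>Inf\<close> have their usual meaning.\<close>
  have bdd: "bdd_above {y. f y < \<tau>}" if "f b > \<tau>" "mono f" for f :: "real \<Rightarrow> real" and b
    using sep[OF _ that] less_imp_le by (auto simp: bdd_above_def)
  have bdd': "bdd_below {y. f y > \<tau>}" if "f b < \<tau>" "mono f" for f :: "real \<Rightarrow> real" and b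
    using sep[OF that(1) _ that(2)] less_imp_le by (auto simp: bdd_below_def)
  \<comment> \<open>The end points are in the right order, so the interval is nonempty and the
    extrema over it are not default values.\<close>
  have SI: "Sup {y. f y < \<tau>} \<le> Inf {y. f y > \<tau>}" if "f a < \<tau>" "f b > \<tau>" "mono f" for f :: "real \<Rightarrow> real" and a b
    using that sep[OF _ _ that(3)] by (intro cSup_least cInf_greatest) (auto intro: less_imp_le)
  obtain yl yh where y: "k yl < \<tau>" "k yh > \<tau>" using low high by auto
  have q: "ql \<le> qu" unfolding ql_def qu_def by (rule SI[OF y mono(1)])
  obtain a where a: "a \<in> \<rat>" "ql - e / 2 < a" "a < ql" using Rats_dense_in_real[of "ql - e / 2" ql] e by auto
  obtain b where b: "b \<in> \<rat>" "qu < b" "b < qu + e / 2" using Rats_dense_in_real[of qu "qu + e / 2"] e by auto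
  have "k a < \<tau>"
  proof -
    obtain c where "k c < \<tau>" "a < c"
      using less_cSupD[of "{y. k y < \<tau>}" a] a y unfolding ql_def by auto
    then show ?thesis using monoD[OF mono(1), of a c] by auto
  qed
  moreover have "k b > \<tau>"
  proof -
    obtain c where "k c > \<tau>" "c < b"
      using cInf_lessD[of "{y. k y > \<tau>}" b] b y unfolding qu_def by auto
    then show ?thesis using monoD[OF mono(1), of c b] by auto
  qed
  ultimately have "\<forall>\<^sub>F n in sequentially. kn n a < \<tau>" "\<forall>\<^sub>F n in sequentially. kn n b > \<tau>"
    using order_tendstoD[OF lim[OF a(1)]] order_tendstoD[OF lim[OF b(1)]] by auto
  then show "\<forall>\<^sub>F n in sequentially. dist (SUP z \<in> {Sup {y. kn n y < \<tau>}..Inf {y. kn n y > \<tau>}}.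
            INF y \<in> {Sup {y. k y < \<tau>}..Inf {y. k y > \<tau>}}. \<bar>z - y\<bar>) 0 < e"
    unfolding ql_def[symmetric] qu_def[symmetric]
  proof eventually_elim
    case (elim n)
    define l where "l = Sup {y. kn n y < \<tau>}"
    define h where "h = Inf {y. kn n y > \<tau>}"
    have lh: "l \<le> h" unfolding l_def h_def by (rule SI[OF elim mono(2)])
    have la: "a \<le> l" unfolding l_def
      using elim bdd[OF elim(2) mono(2)] by (intro cSup_upper) auto
    have hb: "h \<le> b" unfolding h_def
      using elim bdd'[OF elim(1) mono(2)] by (intro cInf_lower) auto
    have *: "0 \<le> (INF y \<in> {ql..qu}. \<bar>z - y\<bar>) \<and> (INF y \<in> {ql..qu}. \<bar>z - y\<bar>) \<le> e / 2" if "z \<in> {l..h}" for z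
    proof
      show "0 \<le> (INF y \<in> {ql..qu}. \<bar>z - y\<bar>)" using q by (intro cINF_greatest) auto
      have bb: "bdd_below ((\<lambda>y. \<bar>z - y\<bar>) ` {ql..qu})" by (auto simp: bdd_below_def intro!: exI[of _ 0])
      \<comment> \<open>The point of [ql, qu] nearest to z.\<close>
      define p where "p = max ql (min qu z)"
      have "p \<in> {ql..qu}" using q by (auto simp: p_def)
      then have "(INF y \<in> {ql..qu}. \<bar>z - y\<bar>) \<le> \<bar>z - p\<bar>" by (intro cINF_lower bb)
      also have "\<bar>z - p\<bar> \<le> e / 2" using that la hb a b q e by (auto simp: p_def max_def min_def)
      finally show "(INF y \<in> {ql..qu}. \<bar>z - y\<bar>) \<le> e / 2" .
    qed
    have "(SUP z \<in> {l..h}. INF y \<in> {ql..qu}. \<bar>z - y\<bar>) \<le> e / 2"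
      using lh * by (intro cSUP_least) auto
    moreover have "0 \<le> (SUP z \<in> {l..h}. INF y \<in> {ql..qu}. \<bar>z - y\<bar>)"
      using lh * by (intro cSUP_upper2[of _ _ l]) (auto intro!: bdd_aboveI[of _ "e / 2"])
    ultimately show ?case using e by (simp add: l_def h_def)
  qed
qed

section \<open>The empirical copula\<close>

definition rank :: "(nat \<Rightarrow> real) \<Rightarrow> nat \<Rightarrow> nat \<Rightarrow> nat" where
  "rank x n k = card {i. i < n \<and> x i \<le> x k}"

text \<open>If t lies below \<open>x k\<close>, the count up to t misses at least the index k.
  Conditions on the data thus become conditions on counts, which lets the empirical distribution
  function factor through its margins.\<close>

lemma rank_le_card_iff:
  assumes "k < n"
  shows "rank x n k \<le> card {i. i < n \<and> x i \<le> t} \<longleftrightarrow> x k \<le> t"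
proof
  assume "x k \<le> t"
  then show "rank x n k \<le> card {i. i < n \<and> x i \<le> t}"
    unfolding rank_def by (intro card_mono) auto
next
  assume r: "rank x n k \<le> card {i. i < n \<and> x i \<le> t}"
  show "x k \<le> t"
  proof (rule ccontr)
    assume "\<not> x k \<le> t"
    then have "{i. i < n \<and> x i \<le> t} \<subset> {i. i < n \<and> x i \<le> x k}"
      using assms by auto
    then have "card {i. i < n \<and> x i \<le> t} < rank x n k"
      unfolding rank_def by (intro psubset_card_mono) auto
    with r show False by simp
  qed
qed

lemma rank_bij:
  assumes "inj_on x {..<n}"
  shows "bij_betw (rank x n) {..<n} {1..n}"
proof -
  have inj: "inj_on (rank x n) {..<n}"
  proof (rule inj_onI)
    fix k l assume kl: "k \<in> {..<n}" "l \<in> {..<n}" "rank x n k = rank x n l"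
    then have "x k \<le> x l" "x l \<le> x k"
      using rank_le_card_iff[of k n x "x l"] rank_le_card_iff[of l n x "x k"] by (auto simp: rank_def)
    then show "k = l" using assms kl by (auto dest: inj_onD)
  qed
  have "rank x n ` {..<n} \<subseteq> {1..n}"
  proof
    fix r assume "r \<in> rank x n ` {..<n}"
    then obtain k where k: "k < n" "r = rank x n k" by auto
    have "card {i. i < n \<and> x i \<le> x k} \<le> card {..<n}" by (intro card_mono) auto
    moreover have "card {i. i < n \<and> x i \<le> x k} > 0" using k by (auto simp: card_gt_0_iff)
    ultimately show "r \<in> {1..n}" using k by (auto simp: rank_def)
  qed
  then have "rank x n ` {..<n} = {1..n}"
    using inj by (intro card_subset_eq) (auto simp: card_image)
  with inj show ?thesis by (simp add: bij_betw_def)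
qed

text \<open>Without ties the counting function takes every value between 0 and n. This makes the
  subcopula relation determine every grid value.\<close>

lemma ex_card_le_eq:
  assumes "inj_on x {..<n}" "i \<le> n"
  obtains t :: real where "card {k. k < n \<and> x k \<le> t} = i"
proof (cases "i = 0")
  case True
  have "card {k. k < n \<and> x k \<le> Min (x ` {..<n}) - 1} = 0"
  proof -
    have "Min (x ` {..<n}) \<le> x k" if "k < n" for k using that by (intro Min_le) auto
    then have "\<not> x k \<le> Min (x ` {..<n}) - 1" if "k < n" for k using that by fastforce
    then have "{k. k < n \<and> x k \<le> Min (x ` {..<n}) - 1} = {}" by blast
    then show ?thesis by simp
  qed
  then show ?thesis using that True by blast
next
  case False
  then have "i \<in> rank x n ` {..<n}" using rank_bij[OF assms(1)] assms(2) by (auto simp: bij_betw_def)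
  then show ?thesis using that by (auto simp: rank_def)
qed

text \<open>The candidate for \<open>emp_subcopula\<close>: the joint empirical distribution
  function of the rank pairs, with the value 0 off the grid that \<open>is_grid_subcopula\<close>
  prescribes.\<close>

definition rank_df :: "(nat \<Rightarrow> real) \<Rightarrow> (nat \<Rightarrow> real) \<Rightarrow> nat \<Rightarrow> nat \<Rightarrow> nat \<Rightarrow> real" where
  "rank_df x y n i j = (if i \<le> n \<and> j \<le> n then
     (\<Sum>k<n. of_bool (rank x n k \<le> i) * of_bool (rank y n k \<le> j)) / n else 0)"

lemma emp_joint_df_eq_sum:
  "emp_joint_df x y n s t = (\<Sum>k<n. of_bool (x k \<le> s) * of_bool (y k \<le> t)) / n"
proof -
  have "(\<Sum>k<n. of_bool (x k \<le> s) * of_bool (y k \<le> t) :: real) = (\<Sum>k<n. of_bool (x k \<le> s \<and> y k \<le> t))"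
    by (intro sum.cong) auto
  also have "\<dots> = card {k. k < n \<and> x k \<le> s \<and> y k \<le> t}"
    by (subst sum_of_bool_eq) (auto intro!: arg_cong[of _ _ card])
  finally show ?thesis by (simp add: emp_joint_df_def)
qed

lemma card_le_n: "card {i. i < n \<and> P i} \<le> n" for n :: nat
proof -
  have "card {i. i < n \<and> P i} \<le> card {..<n}" by (intro card_mono) auto
  then show ?thesis by simp
qed

lemma emp_joint_df_rank_df:
  "emp_joint_df x y n s t = rank_df x y n (card {i. i < n \<and> x i \<le> s}) (card {i. i < n \<and> y i \<le> t})"
proof -
  show ?thesis
    unfolding emp_joint_df_eq_sum rank_df_def
    by (simp add: card_le_n rank_le_card_iff)
qed

lemma sum_rank_le:
  assumes "inj_on x {..<n}" "i \<le> n"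
  shows "(\<Sum>k<n. of_bool (rank x n k \<le> i) :: real) = i"
proof -
  have "(\<Sum>k<n. of_bool (rank x n k \<le> i) :: real) = (\<Sum>r\<in>{1..n}. of_bool (r \<le> i))"
    by (rule sum.reindex_bij_betw[OF rank_bij[OF assms(1)]])
  also have "\<dots> = (\<Sum>r\<in>{1..i}. 1)"
    using assms(2) by (intro sum.mono_neutral_cong_right) auto
  finally show ?thesis by simp
qed

lemma rank_range:
  assumes "inj_on x {..<n}" "k < n"
  shows "1 \<le> rank x n k" "rank x n k \<le> n"
  using bij_betwE[OF rank_bij[OF assms(1)]] assms(2) by auto

text \<open>Without ties the ranks are permutations of 1, ..., n, hence the margins are uniform. The
  volume of a grid rectangle counts the rank pairs inside it.\<close>

lemma is_grid_subcopula_rank_df: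
  assumes x: "inj_on x {..<n}" and y: "inj_on y {..<n}"
  shows "is_grid_subcopula n (rank_df x y n)"
proof -
  let ?r = "rank x n" and ?s = "rank y n"
  have z: "rank_df x y n i 0 = 0" "rank_df x y n 0 i = 0" for i
    using rank_range[OF x] rank_range[OF y] by (fastforce simp: rank_df_def intro!: sum.neutral)+
  have n: "rank_df x y n i n = i / n" "rank_df x y n n i = i / n" if "i \<le> n" for i
  proof -
    have "(\<Sum>k<n. of_bool (?r k \<le> i) * of_bool (?s k \<le> n) :: real) = (\<Sum>k<n. of_bool (?r k \<le> i))"
      using rank_range[OF y] by (intro sum.cong) auto
    then show "rank_df x y n i n = i / n" 
      using that sum_rank_le[OF x that] by (simp only: rank_df_def if_True simp_thms order.refl)
    have "(\<Sum>k<n. of_bool (?r k \<le> n) * of_bool (?s k \<le> i) :: real) = (\<Sum>k<n. of_bool (?s k \<le> i))"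
      using rank_range[OF x] by (intro sum.cong) auto
    then show "rank_df x y n n i = i / n" 
      using that sum_rank_le[OF y that] by (simp only: rank_df_def if_True simp_thms order.refl)
  qed
  have "rank_df x y n i2 j2 - rank_df x y n i1 j2 - rank_df x y n i2 j1 + rank_df x y n i1 j1 \<ge> 0"
    if i: "i1 \<le> i2" "i2 \<le> n" "j1 \<le> j2" "j2 \<le> n" for i1 i2 j1 j2
  proof -
    have ij: "i1 \<le> n" "j1 \<le> n" using i by auto
    have "rank_df x y n i2 j2 - rank_df x y n i1 j2 - rank_df x y n i2 j1 + rank_df x y n i1 j1 =
      (\<Sum>k<n. of_bool (?r k \<le> i2) * of_bool (?s k \<le> j2) - of_bool (?r k \<le> i1) * of_bool (?s k \<le> j2)
        - of_bool (?r k \<le> i2) * of_bool (?s k \<le> j1) + of_bool (?r k \<le> i1) * of_bool (?s k \<le> j1)) / n"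
      using i ij by (simp only: rank_df_def if_True simp_thms sum.distrib sum_subtractf add_divide_distrib diff_divide_distrib)
    \<comment> \<open>Each summand factors into two increments of increasing indicators, both
      nonnegative.\<close>
    also have "\<dots> = (\<Sum>k<n. (of_bool (?r k \<le> i2) - of_bool (?r k \<le> i1)) * (of_bool (?s k \<le> j2) - of_bool (?s k \<le> j1))) / n"
    proof (intro arg_cong2[of _ _ _ _ "(/)"] sum.cong refl)
      have "p' * q' - p * q' - p' * q + p * q = (p' - p) * (q' - q)" for p p' q q' :: real
        by algebra
      then show "of_bool (?r k \<le> i2) * of_bool (?s k \<le> j2) - of_bool (?r k \<le> i1) * of_bool (?s k \<le> j2)
        - of_bool (?r k \<le> i2) * of_bool (?s k \<le> j1) + of_bool (?r k \<le> i1) * of_bool (?s k \<le> j1) =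
        (of_bool (?r k \<le> i2) - of_bool (?r k \<le> i1)) * (of_bool (?s k \<le> j2) - of_bool (?s k \<le> j1) :: real)" for k .
    qed
    also have "\<dots> \<ge> 0"
      using i by (intro divide_nonneg_nonneg sum_nonneg mult_nonneg_nonneg) auto
    finally show ?thesis .
  qed
  moreover have "rank_df x y n i j = 0" if "n < i \<or> n < j" for i j
    using that by (auto simp: rank_df_def)
  ultimately show ?thesis unfolding is_grid_subcopula_def using z n by blast
qed

lemma emp_subcopula_eq:
  assumes x: "inj_on x {..<n}" and y: "inj_on y {..<n}"
  shows "emp_subcopula x y n = rank_df x y n"
  unfolding emp_subcopula_def
proof (rule the_equality)
  show "is_grid_subcopula n (rank_df x y n) \<and> (\<forall>s t. emp_joint_df x y n s t =
      rank_df x y n (card {i. i < n \<and> x i \<le> s}) (card {i. i < n \<and> y i \<le> t}))"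
    using is_grid_subcopula_rank_df[OF x y] emp_joint_df_rank_df by blast
next
  fix e assume e: "is_grid_subcopula n e \<and> (\<forall>s t. emp_joint_df x y n s t =
      e (card {i. i < n \<and> x i \<le> s}) (card {i. i < n \<and> y i \<le> t}))"
  show "e = rank_df x y n"
  proof (intro ext)
    fix i j
    show "e i j = rank_df x y n i j"
    proof (cases "i \<le> n \<and> j \<le> n")
      case True
      obtain s where s: "card {k. k < n \<and> x k \<le> s} = i" using ex_card_le_eq[OF x] True by blast
      obtain t where t: "card {k. k < n \<and> y k \<le> t} = j" using ex_card_le_eq[OF y] True by blast
      have "emp_joint_df x y n s t = e (card {k. k < n \<and> x k \<le> s}) (card {k. k < n \<and> y k \<le> t})"
        using e by blast
      then have "e i j = emp_joint_df x y n s t" by (simp only: s t)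
      also have "\<dots> = rank_df x y n i j" using emp_joint_df_rank_df[of x y n s t] by (simp only: s t)
      finally show ?thesis .
    next
      case False
      then show ?thesis using e by (auto simp: is_grid_subcopula_def rank_df_def)
    qed
  qed
qed

section \<open>Bilinear interpolation as uniform spreading of mass\<close>

definition ramp :: "real \<Rightarrow> real" where
  "ramp z = max 0 (min 1 z)"

text \<open>Interpolating a unit jump at the integer r linearly gives a ramp on [r - 1, r];
  \<open>ramp\<close> itself is the distribution function of the uniform law on [0,1]. The cases
  place the interpolation cell above, on or below the sloping part.\<close>

lemma ramp_interp:
  assumes "r \<ge> 1" "0 \<le> a" "a \<le> 1"
  shows "(1 - a) * of_bool (r \<le> i) + a * of_bool (r \<le> Suc i) = ramp (real i + a - (real r - 1))"
proof -
  consider "r \<le> i" | "r = Suc i" | "r \<ge> i + 2" by linarith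
  then show ?thesis
  proof cases
    case 1
    then show ?thesis using assms by (auto simp: ramp_def)
  next
    case 2
    then show ?thesis using assms by (auto simp: ramp_def)
  next
    case 3
    then have "real r \<ge> real i + 2" by linarith
    then show ?thesis using 3 assms by (auto simp: ramp_def)
  qed
qed

text \<open>The cell index is capped at \<open>n - 1\<close>, so that the right end point \<open>1\<close> is interpolated
  inside the last cell.\<close>
lemma cell_index:
  fixes u :: real
  assumes "n \<ge> 1" "u \<in> {0..1}"
  defines "i \<equiv> min (nat \<lfloor>real n * u\<rfloor>) (n - 1)"
  shows "i < n" "0 \<le> n * u - i" "n * u - i \<le> 1"
proof -
  show "i < n" using assms by (auto simp: i_def)
  have nu: "0 \<le> n * u" "n * u \<le> n" using assms by (auto simp: mult_le_cancel_left2)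
  then have "real (nat \<lfloor>n * u\<rfloor>) \<le> n * u" by simp
  then show "0 \<le> n * u - i" by (auto simp: i_def min_def)
  have "n * u < real (nat \<lfloor>n * u\<rfloor>) + 1" using nu by linarith
  moreover have "real (n - 1) = real n - 1" using assms by simp
  ultimately show "n * u - i \<le> 1" using nu
    unfolding i_def min_def by (smt (verit))
qed

text \<open>The four bilinear weights are products, and so are the indicators summed in
  \<open>rank_df\<close>; hence each observation contributes a product of two one-dimensional
  interpolations. In this form the density can be read off.\<close>

lemma emp_copula_eq:
  assumes x: "inj_on x {..<n}" and y: "inj_on y {..<n}" and n: "n \<ge> 1"
    and u: "u \<in> {0..1}" and v: "v \<in> {0..1}"
  shows "emp_copula x y n u v =
    (\<Sum>k<n. ramp (n * u - (real (rank x n k) - 1)) * ramp (n * v - (real (rank y n k) - 1))) / n"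
proof -
  define i where "i = min (nat \<lfloor>real n * u\<rfloor>) (n - 1)"
  define j where "j = min (nat \<lfloor>real n * v\<rfloor>) (n - 1)"
  define a where "a = n * u - i"
  define b where "b = n * v - j"
  have i: "i < n" "0 \<le> a" "a \<le> 1" using cell_index[OF n u] by (auto simp: i_def a_def)
  have j: "j < n" "0 \<le> b" "b \<le> 1" using cell_index[OF n v] by (auto simp: j_def b_def)
  let ?r = "rank x n" and ?s = "rank y n"
  have "emp_copula x y n u v = (1 - a) * (1 - b) * rank_df x y n i j + a * (1 - b) * rank_df x y n (Suc i) j
         + (1 - a) * b * rank_df x y n i (Suc j) + a * b * rank_df x y n (Suc i) (Suc j)"
    unfolding emp_copula_def emp_subcopula_eq[OF x y] bilinear_ext_def Let_def a_def b_def i_def j_def ..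
  also have "\<dots> = (\<Sum>k<n. ((1 - a) * of_bool (?r k \<le> i) + a * of_bool (?r k \<le> Suc i)) *
       ((1 - b) * of_bool (?s k \<le> j) + b * of_bool (?s k \<le> Suc j))) / n"
  proof -
    have ij: "i \<le> n" "Suc i \<le> n" "j \<le> n" "Suc j \<le> n" using i j by auto
    have "(1 - a) * (1 - b) * rank_df x y n i j + a * (1 - b) * rank_df x y n (Suc i) j
         + (1 - a) * b * rank_df x y n i (Suc j) + a * b * rank_df x y n (Suc i) (Suc j) =
      (\<Sum>k<n. (1 - a) * (1 - b) * (of_bool (?r k \<le> i) * of_bool (?s k \<le> j))
         + a * (1 - b) * (of_bool (?r k \<le> Suc i) * of_bool (?s k \<le> j))
         + (1 - a) * b * (of_bool (?r k \<le> i) * of_bool (?s k \<le> Suc j))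
         + a * b * (of_bool (?r k \<le> Suc i) * of_bool (?s k \<le> Suc j))) / n"
      using ij by (simp only: rank_df_def if_True simp_thms sum.distrib add_divide_distrib sum_distrib_left[symmetric] times_divide_eq_right)
    also have "\<dots> = (\<Sum>k<n. ((1 - a) * of_bool (?r k \<le> i) + a * of_bool (?r k \<le> Suc i)) *
       ((1 - b) * of_bool (?s k \<le> j) + b * of_bool (?s k \<le> Suc j))) / n"
    proof (intro arg_cong2[of _ _ _ _ "(/)"] sum.cong refl)
      have "(1 - a) * (1 - b) * (p * q) + a * (1 - b) * (p' * q) + (1 - a) * b * (p * q') + a * b * (p' * q') =
        ((1 - a) * p + a * p') * ((1 - b) * q + b * q')" for p p' q q' :: real
        by algebra
      then show "(1 - a) * (1 - b) * (of_bool (?r k \<le> i) * of_bool (?s k \<le> j))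
         + a * (1 - b) * (of_bool (?r k \<le> Suc i) * of_bool (?s k \<le> j))
         + (1 - a) * b * (of_bool (?r k \<le> i) * of_bool (?s k \<le> Suc j))
         + a * b * (of_bool (?r k \<le> Suc i) * of_bool (?s k \<le> Suc j)) =
         ((1 - a) * of_bool (?r k \<le> i) + a * of_bool (?r k \<le> Suc i)) *
         ((1 - b) * of_bool (?s k \<le> j) + b * of_bool (?s k \<le> Suc j))" for k .
    qed
    finally show ?thesis .
  qed
  also have "\<dots> = (\<Sum>k<n. ramp (n * u - (real (rank x n k) - 1)) * ramp (n * v - (real (rank y n k) - 1))) / n"
  proof -
    have "((1 - a) * of_bool (?r k \<le> i) + a * of_bool (?r k \<le> Suc i)) *
       ((1 - b) * of_bool (?s k \<le> j) + b * of_bool (?s k \<le> Suc j)) =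
       ramp (n * u - (real (?r k) - 1)) * ramp (n * v - (real (?s k) - 1))" if "k < n" for k
      using ramp_interp[of "?r k" a i] ramp_interp[of "?s k" b j] rank_range[OF x that] rank_range[OF y that] i j
      by (simp add: a_def b_def)
    then show ?thesis by (intro arg_cong2[of _ _ _ _ "(/)"] sum.cong) auto
  qed
  finally show ?thesis .
qed

text \<open>Observation k owns the square of side 1/n whose upper right corner is its rank pair
  divided by n. Mass 1/n on area 1/n^2 gives height n.\<close>

definition emp_density :: "(nat \<Rightarrow> real) \<Rightarrow> (nat \<Rightarrow> real) \<Rightarrow> nat \<Rightarrow> real \<times> real \<Rightarrow> ennreal" where
  "emp_density x y n p = (\<Sum>k<n. ennreal n * indicator
     ({(real (rank x n k) - 1) / n <.. real (rank x n k) / n} \<times> {(real (rank y n k) - 1) / n <.. real (rank y n k) / n}) p)"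

lemma emeasure_lborel_Icc_Int_Ioc:
  assumes "u \<ge> 0" "n \<ge> 1" "r \<ge> 1"
  shows "emeasure lborel ({0..u} \<inter> {(real r - 1) / real n <.. real r / n}) = ennreal (ramp (n * u - (real r - 1)) / n)"
proof -
  have "0 \<le> (real r - 1) / n" using assms by auto
  then have eq: "{0..u} \<inter> {(real r - 1) / n <.. real r / n} = {(real r - 1) / n <.. min u (real r / n)}"
    by auto
  have rn: "real r / n = (real r - 1) / n + 1 / n" by (simp add: diff_divide_distrib)
  have "real n > 0" using assms by simp
  have "max 0 (min u (real r / n) - (real r - 1) / n) = ramp (n * u - (real r - 1)) / n"
  proof -
    have *: "(n * u - (real r - 1)) / n = u - (real r - 1) / n" using assms by (simp add: field_simps)
    have "ramp z / n = max 0 (min (1 / n) (z / n))" for z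
      using \<open>real n > 0\<close> by (auto simp: ramp_def max_def min_def divide_simps)
    moreover have "max 0 (min u (p + q) - p) = max 0 (min q (u - p))" for p q
      by (auto simp: max_def min_def)
    ultimately show ?thesis using * rn by metis
  qed
  moreover have "emeasure lborel {a<..b} = ennreal (max 0 (b - a))" for a b :: real
    by (cases "a \<le> b") (auto simp: max_def ennreal_neg)
  ultimately show ?thesis unfolding eq by (simp only:)
qed

lemma is_dsm_emp_copula:
  assumes x: "inj_on x {..<n}" and y: "inj_on y {..<n}" and n: "n \<ge> 1"
  shows "is_dsm (emp_copula x y n) (density lborel (emp_density x y n))"
proof -
  let ?r = "rank x n" and ?s = "rank y n"
  let ?I = "\<lambda>k. {(real (?r k) - 1) / n <.. real (?r k) / n}"
  let ?J = "\<lambda>k. {(real (?s k) - 1) / n <.. real (?s k) / n}"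
  let ?\<mu> = "density lborel (emp_density x y n)"
  have IJ: "?I k \<times> ?J k \<in> sets borel" for k
    unfolding borel_prod[symmetric] by (intro pair_measureI) auto
  have [measurable]: "emp_density x y n \<in> borel_measurable lborel"
    unfolding emp_density_def using IJ by (auto intro!: borel_measurable_sum borel_measurable_times)
  have E: "emeasure ?\<mu> S = (\<Sum>k<n. ennreal n * emeasure lborel (S \<inter> ?I k \<times> ?J k))"
    if S: "S \<in> sets borel" for S
  proof -
    have "emeasure ?\<mu> S = (\<integral>\<^sup>+p. emp_density x y n p * indicator S p \<partial>lborel)"
      using S by (intro emeasure_density) auto
    also have "\<dots> = (\<integral>\<^sup>+p. (\<Sum>k<n. ennreal n * indicator (S \<inter> ?I k \<times> ?J k) p) \<partial>lborel)"
      unfolding emp_density_def sum_distrib_right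
      by (intro nn_integral_cong sum.cong refl) (auto simp: indicator_def)
    also have "\<dots> = (\<Sum>k<n. \<integral>\<^sup>+p. ennreal n * indicator (S \<inter> ?I k \<times> ?J k) p \<partial>lborel)"
      using S IJ by (intro nn_integral_sum) auto
    also have "\<dots> = (\<Sum>k<n. ennreal n * emeasure lborel (S \<inter> ?I k \<times> ?J k))"
      using S IJ by (intro sum.cong refl nn_integral_cmult_indicator) auto
    finally show ?thesis .
  qed
  have R: "emeasure ?\<mu> ({0..u} \<times> {0..v}) = ennreal (emp_copula x y n u v)"
    if "u \<in> {0..1}" "v \<in> {0..1}" for u v
  proof -
    have S: "{0..u} \<times> {0..v} \<in> sets borel" by (intro borel_closed closed_Times) auto
    \<comment> \<open>The intersection has area equal to the product of the two ramps over n^2; the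
      height n leaves one factor 1/n.\<close>
    have "ennreal n * emeasure lborel ({0..u} \<times> {0..v} \<inter> ?I k \<times> ?J k) =
        ennreal (ramp (n * u - (real (?r k) - 1)) * ramp (n * v - (real (?s k) - 1)) / n)" if k: "k < n" for k
    proof -
      have "emeasure lborel ({0..u} \<times> {0..v} \<inter> ?I k \<times> ?J k) =
        emeasure (lborel \<Otimes>\<^sub>M lborel) (({0..u} \<inter> ?I k) \<times> ({0..v} \<inter> ?J k))"
        by (simp add: lborel_prod Times_Int_Times)
      also have "\<dots> = emeasure lborel ({0..u} \<inter> ?I k) * emeasure lborel ({0..v} \<inter> ?J k)"
        by (intro lborel.emeasure_pair_measure_Times) auto
      also have "\<dots> = ennreal (ramp (n * u - (real (?r k) - 1)) / n) * ennreal (ramp (n * v - (real (?s k) - 1)) / n)"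
        using \<open>u \<in> _\<close> \<open>v \<in> _\<close> n rank_range[OF x k] rank_range[OF y k]
        by (simp add: emeasure_lborel_Icc_Int_Ioc)
      finally show ?thesis
        using n by (simp add: ennreal_mult[symmetric] ramp_def)
    qed
    then have "emeasure ?\<mu> ({0..u} \<times> {0..v}) =
      (\<Sum>k<n. ennreal (ramp (n * u - (real (?r k) - 1)) * ramp (n * v - (real (?s k) - 1)) / n))"
      unfolding E[OF S] by (intro sum.cong) auto
    also have "\<dots> = ennreal (emp_copula x y n u v)"
      unfolding emp_copula_eq[OF x y n that] sum_divide_distrib by (intro sum_ennreal) (auto simp: ramp_def)
    finally show ?thesis .
  qed
  have C: "emeasure ?\<mu> (UNIV - {0..1} \<times> {0..1}) = 0"
  proof -
    have "(UNIV - {0..1} \<times> {0..1}) \<inter> ?I k \<times> ?J k = {}" if k: "k < n" for k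
    proof -
      have "0 \<le> (real (?r k) - 1) / n" "real (?r k) / n \<le> 1" "0 \<le> (real (?s k) - 1) / n" "real (?s k) / n \<le> 1"
        using n rank_range[OF x k] rank_range[OF y k] by (auto simp: divide_simps)
      then show ?thesis by (auto; linarith)
    qed
    moreover have "(UNIV - {0..1::real} \<times> {0..1::real}) \<in> sets borel"
      by (auto intro!: borel_open open_Diff closed_Times)
    ultimately show ?thesis by (simp add: E)
  qed
  have fin: "finite_measure ?\<mu>"
  proof
    have "{0..1::real} \<times> {0..1::real} \<in> sets borel" by (auto intro!: borel_closed closed_Times)
    then have "emeasure ?\<mu> UNIV = emeasure ?\<mu> ({0..1} \<times> {0..1}) + emeasure ?\<mu> (UNIV - {0..1} \<times> {0..1})"
      by (subst plus_emeasure) auto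
    then show "emeasure ?\<mu> (space ?\<mu>) \<noteq> \<infinity>" using R[of 1 1] C by simp
  qed
  have "measure ?\<mu> ({0..u} \<times> {0..v}) = emp_copula x y n u v" if "u \<in> {0..1}" "v \<in> {0..1}" for u v
    using R[OF that] emp_copula_eq[OF x y n that]
    by (intro measure_eq_emeasure_eq_ennreal) (auto simp: ramp_def intro!: divide_nonneg_nonneg sum_nonneg mult_nonneg_nonneg)
  then show ?thesis using fin C by (simp add: is_dsm_def)
qed

lemma emp_copula_zero:
  assumes x: "inj_on x {..<n}" and y: "inj_on y {..<n}" and n: "n \<ge> 1" and u: "u \<in> {0..1}"
  shows "emp_copula x y n u 0 = 0" "emp_copula x y n 0 u = 0"
proof -
  have "ramp (1 - real (rank x n k)) = 0" "ramp (1 - real (rank y n k)) = 0" if "k < n" for k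
    using rank_range[OF x that] rank_range[OF y that] by (auto simp: ramp_def)
  then show "emp_copula x y n u 0 = 0" "emp_copula x y n 0 u = 0"
    using u n by (simp_all add: emp_copula_eq[OF x y])
qed

text \<open>At a grid point, one \<open>\<delta>\<close> comes from the joint distribution function
  and one from each margin via the Lipschitz property. Moving from (u, v) to a corner of its cell
  costs 1/n per coordinate. Interpolation is a convex combination of the four corners and preserves
  the bound.\<close>

lemma emp_copula_close:
  assumes x: "inj_on x {..<n}" and y: "inj_on y {..<n}" and n: "n \<ge> 1" and A: "is_copula A"
    and FG: "\<And>t. F t \<in> {0..1}" "\<And>t. G t \<in> {0..1}"
    and F: "\<And>t. \<bar>emp_df x n t - F t\<bar> \<le> \<delta>" and G: "\<And>t. \<bar>emp_df y n t - G t\<bar> \<le> \<delta>"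
    and H: "\<And>s t. \<bar>emp_joint_df x y n s t - A (F s) (G t)\<bar> \<le> \<delta>"
    and u: "u \<in> {0..1}" and v: "v \<in> {0..1}"
  shows "\<bar>emp_copula x y n u v - A u v\<bar> \<le> 3 * \<delta> + 2 / n"
proof -
  have grid: "\<bar>rank_df x y n i j - A (i / n) (j / n)\<bar> \<le> 3 * \<delta>" if ij: "i \<le> n" "j \<le> n" for i j
  proof -
    obtain s where s: "card {k. k < n \<and> x k \<le> s} = i" using ex_card_le_eq[OF x ij(1)] by blast
    obtain t where t: "card {k. k < n \<and> y k \<le> t} = j" using ex_card_le_eq[OF y ij(2)] by blast
    have "\<bar>A (F s) (G t) - A (i / n) (j / n)\<bar> \<le> \<bar>F s - i / n\<bar> + \<bar>G t - j / n\<bar>"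
      using ij n by (intro copula_lipschitz A FG) auto
    moreover have "\<bar>i / n - F s\<bar> \<le> \<delta>" "\<bar>j / n - G t\<bar> \<le> \<delta>"
      using F[of s] G[of t] s t by (auto simp: emp_df_def)
    moreover have "\<bar>rank_df x y n i j - A (F s) (G t)\<bar> \<le> \<delta>"
      using H[of s t] emp_joint_df_rank_df[of x y n s t] s t by simp
    ultimately show ?thesis by linarith
  qed
  define i where "i = min (nat \<lfloor>real n * u\<rfloor>) (n - 1)"
  define j where "j = min (nat \<lfloor>real n * v\<rfloor>) (n - 1)"
  define a where "a = n * u - i"
  define b where "b = n * v - j"
  have i: "i < n" "0 \<le> a" "a \<le> 1" using cell_index[OF n u] by (auto simp: i_def a_def)
  have j: "j < n" "0 \<le> b" "b \<le> 1" using cell_index[OF n v] by (auto simp: j_def b_def)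
  have np: "real n > 0" using n by simp
  have near: "\<bar>real i' / n - u\<bar> \<le> 1 / n" if "i' = i \<or> i' = Suc i" for i'
  proof -
    have "\<bar>real i' - n * u\<bar> \<le> 1" using that i by (auto simp: a_def)
    then have "\<bar>real i' - n * u\<bar> / n \<le> 1 / n" using np by (intro divide_right_mono) auto
    moreover have "real i' / n - u = (real i' - n * u) / n"
      using np by (simp add: field_simps)
    ultimately show ?thesis by (simp add: abs_divide)
  qed
  have near': "\<bar>real j' / n - v\<bar> \<le> 1 / n" if "j' = j \<or> j' = Suc j" for j'
  proof -
    have "\<bar>real j' - n * v\<bar> \<le> 1" using that j by (auto simp: b_def)
    then have "\<bar>real j' - n * v\<bar> / n \<le> 1 / n" using np by (intro divide_right_mono) auto
    moreover have "real j' / n - v = (real j' - n * v) / n"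
      using np by (simp add: field_simps)
    ultimately show ?thesis by (simp add: abs_divide)
  qed
  define D where "D = 3 * \<delta> + 2 / n"
  have corner: "\<bar>rank_df x y n i' j' - A u v\<bar> \<le> D"
    if "i' = i \<or> i' = Suc i" "j' = j \<or> j' = Suc j" for i' j'
  proof -
    have ij: "i' \<le> n" "j' \<le> n" using that i j by auto
    have "\<bar>A (i' / n) (j' / n) - A u v\<bar> \<le> \<bar>i' / n - u\<bar> + \<bar>j' / n - v\<bar>"
      using ij n u v by (intro copula_lipschitz A) auto
    then show ?thesis using grid[OF ij] near[OF that(1)] near'[OF that(2)]
      unfolding D_def by linarith
  qed
  let ?e = "\<lambda>i j. rank_df x y n i j - A u v"
  have "emp_copula x y n u v - A u v = (1 - a) * ((1 - b) * ?e i j + b * ?e i (Suc j))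
      + a * ((1 - b) * ?e (Suc i) j + b * ?e (Suc i) (Suc j))"
  proof -
    have "(1 - a) * (1 - b) * p + a * (1 - b) * q + (1 - a) * b * r + a * b * t - z =
      (1 - a) * ((1 - b) * (p - z) + b * (r - z)) + a * ((1 - b) * (q - z) + b * (t - z))" for p q r t z :: real
      by algebra
    then show ?thesis
      unfolding emp_copula_def emp_subcopula_eq[OF x y] bilinear_ext_def Let_def
      by (simp only: a_def b_def i_def j_def)
  qed
  note eq = this
  \<comment> \<open>Applied three times: along both horizontal pairs of corners in terms of b, then
    across them in terms of a.\<close>
  have conv: "\<bar>(1 - c) * p + c * q\<bar> \<le> D" if "0 \<le> c" "c \<le> 1" "\<bar>p\<bar> \<le> D" "\<bar>q\<bar> \<le> D" for c p q
  proof -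
    have "\<bar>(1 - c) * p + c * q\<bar> \<le> (1 - c) * \<bar>p\<bar> + c * \<bar>q\<bar>"
      using that by (intro order.trans[OF abs_triangle_ineq]) (auto simp: abs_mult)
    also have "\<dots> \<le> (1 - c) * D + c * D" using that by (intro add_mono mult_left_mono) auto
    finally show ?thesis by (simp add: algebra_simps)
  qed
  have "\<bar>(1 - b) * ?e i j + b * ?e i (Suc j)\<bar> \<le> D" "\<bar>(1 - b) * ?e (Suc i) j + b * ?e (Suc i) (Suc j)\<bar> \<le> D"
    by (rule conv[OF j(2,3)]; rule corner; simp)+
  from conv[OF i(2,3) this] show ?thesis unfolding eq D_def .
qed

section \<open>Continuous distribution functions and independence\<close>

context prob_space
begin

text \<open>On {Y \<le> b} an atom of X at a is dominated by the increments of the joint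
  distribution function over shrinking intervals ending at a. Countably many levels b exhaust the
  space.\<close>

lemma no_atom_of_joint_continuous:
  fixes X Y :: "'a \<Rightarrow> real"
  assumes [measurable]: "random_variable borel X" "random_variable borel Y"
    and cont: "\<And>b. continuous_on UNIV (\<lambda>a. prob {\<omega> \<in> space M. X \<omega> \<le> a \<and> Y \<omega> \<le> b})"
  shows "prob {\<omega> \<in> space M. X \<omega> = a} = 0"
proof -
  have z: "prob {\<omega> \<in> space M. X \<omega> = a \<and> Y \<omega> \<le> b} = 0" for b
  proof -
    let ?h = "\<lambda>a. prob {\<omega> \<in> space M. X \<omega> \<le> a \<and> Y \<omega> \<le> b}"
    have le: "prob {\<omega> \<in> space M. X \<omega> = a \<and> Y \<omega> \<le> b} \<le> ?h a - ?h (a - 1 / real (Suc k))" for k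
    proof -
      define d where "d = 1 / real (Suc k)"
      have pos: "0 < d" by (simp add: d_def)
      have "prob ({\<omega> \<in> space M. X \<omega> \<le> a \<and> Y \<omega> \<le> b} -
          {\<omega> \<in> space M. X \<omega> \<le> a - d \<and> Y \<omega> \<le> b}) = ?h a - ?h (a - d)"
        using pos by (intro finite_measure_Diff) auto
      moreover have "prob {\<omega> \<in> space M. X \<omega> = a \<and> Y \<omega> \<le> b} \<le>
          prob ({\<omega> \<in> space M. X \<omega> \<le> a \<and> Y \<omega> \<le> b} - {\<omega> \<in> space M. X \<omega> \<le> a - d \<and> Y \<omega> \<le> b})"
        using pos by (intro finite_measure_mono) auto
      ultimately show ?thesis by (simp add: d_def)
    qed
    have "(\<lambda>k. a - 1 / real (Suc k)) \<longlonglongrightarrow> a - 0"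
      by (intro tendsto_diff tendsto_const LIMSEQ_Suc lim_1_over_n)
    moreover have "isCont ?h a"
      using cont[of b] by (simp add: continuous_on_eq_continuous_at)
    ultimately have "(\<lambda>k. ?h a - ?h (a - 1 / real (Suc k))) \<longlonglongrightarrow> ?h a - ?h a"
      by (intro tendsto_diff tendsto_const isCont_tendsto_compose[of a ?h]) auto
    then have "prob {\<omega> \<in> space M. X \<omega> = a \<and> Y \<omega> \<le> b} \<le> 0"
      using le by (intro LIMSEQ_le_const[of _ 0]) auto
    then show ?thesis by (simp add: measure_le_0_iff)
  qed
  have "AE \<omega> in M. \<not> (X \<omega> = a \<and> Y \<omega> \<le> real m)" for m :: nat
    using z[of "real m"] by (subst (asm) prob_eq_0) auto
  then have "AE \<omega> in M. \<forall>m::nat. \<not> (X \<omega> = a \<and> Y \<omega> \<le> real m)"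
    unfolding AE_all_countable by blast
  then have "AE \<omega> in M. \<not> X \<omega> = a"
    by eventually_elim (use real_arch_simple in blast)
  then show ?thesis by (rule prob_eq_0_AE)
qed

lemma cdf_distr_eq:
  assumes "random_variable borel X"
  shows "cdf (distr M borel X) = (\<lambda>t. prob {\<omega> \<in> space M. X \<omega> \<le> t})"
proof
  fix t
  have "X -` {..t} \<inter> space M = {\<omega> \<in> space M. X \<omega> \<le> t}" by auto
  then show "cdf (distr M borel X) t = prob {\<omega> \<in> space M. X \<omega> \<le> t}"
    using assms by (simp add: cdf_def measure_distr)
qed

lemma cdf_properties:
  fixes X :: "'a \<Rightarrow> real"
  assumes X [measurable]: "random_variable borel X" and atom: "\<And>a. prob {\<omega> \<in> space M. X \<omega> = a} = 0"
  defines "F \<equiv> \<lambda>t. prob {\<omega> \<in> space M. X \<omega> \<le> t}"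
  shows "mono F" "isCont F t" "(F \<longlongrightarrow> 1) at_top" "(F \<longlongrightarrow> 0) at_bot"
proof -
  interpret D: real_distribution "distr M borel X" by simp
  have F: "F = cdf (distr M borel X)" by (simp add: cdf_distr_eq F_def)
  show "mono F" unfolding F by (intro monoI D.cdf_nondecreasing)
  show "(F \<longlongrightarrow> 1) at_top" "(F \<longlongrightarrow> 0) at_bot"
    unfolding F by (rule D.cdf_lim_at_top_prob, rule D.cdf_lim_at_bot)
  have "X -` {t} \<inter> space M = {\<omega> \<in> space M. X \<omega> = t}" by auto
  then have "measure (distr M borel X) {t} = prob {\<omega> \<in> space M. X \<omega> = t}"
    by (simp add: measure_distr)
  then show "isCont F t" unfolding F D.isCont_cdf by (simp add: atom)
qed

text \<open>The largest a-quantile, which turns the event F(X) \<le> a into X \<le> q. It lives only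
  at interior levels: for a = 0 the set {t. F t \<le> a} may be empty, and for a = 1 it is
  unbounded.\<close>

lemma cdf_quantile:
  fixes X :: "'a \<Rightarrow> real"
  assumes X: "random_variable borel X" and atom: "\<And>a. prob {\<omega> \<in> space M. X \<omega> = a} = 0"
  defines "F \<equiv> \<lambda>t. prob {\<omega> \<in> space M. X \<omega> \<le> t}"
  assumes a: "0 < a" "a < 1"
  obtains q where "F q = a" "\<And>t. F t \<le> a \<longleftrightarrow> t \<le> q"
proof -
  note P = cdf_properties[OF X atom, folded F_def]
  obtain l where l: "F l < a"
    using eventually_happens'[OF _ order_tendstoD(2)[OF P(4) a(1)]] by (auto simp: trivial_limit_at_bot_linorder)
  obtain u where u: "F u > a"
    using eventually_happens'[OF _ order_tendstoD(1)[OF P(3) a(2)]] by (auto simp: trivial_limit_at_top_linorder)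
  have "l \<le> u" using monoD[OF P(1), of u l] l u by (cases "l \<le> u") auto
  then obtain z where z: "F z = a" using IVT[of F l a u] l u P(2) by auto
  let ?S = "{t. F t \<le> a}"
  have bdd: "bdd_above ?S"
  proof (rule bdd_aboveI)
    fix t assume "t \<in> ?S"
    then show "t \<le> u" using monoD[OF P(1), of u t] u by (cases "t \<le> u") auto
  qed
  have "closed ?S"
    by (rule closed_Collect_le) (auto intro!: continuous_at_imp_continuous_on P(2))
  then have q: "Sup ?S \<in> ?S" using z bdd by (intro closed_contains_Sup) auto
  show ?thesis
  proof (rule that)
    have "z \<le> Sup ?S" using z bdd by (intro cSup_upper) auto
    then show "F (Sup ?S) = a" using monoD[OF P(1), of z "Sup ?S"] z q by auto
    show "F t \<le> a \<longleftrightarrow> t \<le> Sup ?S" for t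
      using monoD[OF P(1), of t "Sup ?S"] q bdd by (auto intro: cSup_upper)
  qed
qed

lemma prob_integral_transform:
  fixes X :: "'a \<Rightarrow> real"
  assumes X [measurable]: "random_variable borel X" and atom: "\<And>a. prob {\<omega> \<in> space M. X \<omega> = a} = 0"
  defines "F \<equiv> \<lambda>t. prob {\<omega> \<in> space M. X \<omega> \<le> t}"
  assumes a: "a \<in> {0..1}"
  shows "prob {\<omega> \<in> space M. F (X \<omega>) \<le> a} = a"
proof -
  note P = cdf_properties[OF X atom, folded F_def]
  have [measurable]: "F \<in> borel_measurable borel" by (rule borel_measurable_mono[OF P(1)])
  have int: "prob {\<omega> \<in> space M. F (X \<omega>) \<le> a} = a" if a: "0 < a" "a < 1" for a
  proof -
    show ?thesis
    proof (rule cdf_quantile[OF X atom a])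
      fix q assume q: "prob {\<omega> \<in> space M. X \<omega> \<le> q} = a"
        "\<And>t. (prob {\<omega> \<in> space M. X \<omega> \<le> t} \<le> a) = (t \<le> q)"
      show ?thesis using q(1) unfolding F_def q(2) .
    qed
  qed
  consider "a = 0" | "a = 1" | "0 < a" "a < 1" using a by fastforce
  then show ?thesis
  proof cases
    case 1
    \<comment> \<open>Level 0 is approached through interior levels; the cap 1/2 keeps
      \<open>e'\<close> below 1.\<close>
    have "prob {\<omega> \<in> space M. F (X \<omega>) \<le> 0} \<le> 0 + e" if e: "e > 0" for e
    proof -
      define e' where "e' = min e (1 / 2)"
      have "prob {\<omega> \<in> space M. F (X \<omega>) \<le> 0} \<le> prob {\<omega> \<in> space M. F (X \<omega>) \<le> e'}"
        using e by (intro finite_measure_mono) (auto simp: e'_def)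
      also have "\<dots> = e'" using e by (intro int) (auto simp: e'_def)
      finally show ?thesis by (simp add: e'_def)
    qed
    then have "prob {\<omega> \<in> space M. F (X \<omega>) \<le> 0} \<le> 0" by (rule field_le_epsilon)
    with 1 show ?thesis by (simp add: measure_le_0_iff)
  next
    case 2
    have "{\<omega> \<in> space M. F (X \<omega>) \<le> a} = space M" using 2 by (auto simp: F_def)
    then show ?thesis using 2 prob_space by simp
  qed (rule int)
qed

text \<open>By Fubini the product law of two observations gives the diagonal mass 0, since each
  section is a single point and there are no atoms. The pairs of indices are countable.\<close>

lemma indep_no_ties:
  fixes X :: "nat \<Rightarrow> 'a \<Rightarrow> real"
  assumes indep: "indep_vars (\<lambda>_. borel) X UNIV"
    and atom: "\<And>i a. prob {\<omega> \<in> space M. X i \<omega> = a} = 0"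
  shows "AE \<omega> in M. inj (\<lambda>i. X i \<omega>)"
proof -
  have X [measurable]: "random_variable borel (X i)" for i
    using indep by (auto simp: indep_vars_def)
  have "AE \<omega> in M. X i \<omega> \<noteq> X j \<omega>" if ij: "i \<noteq> j" for i j
  proof -
    \<comment> \<open>Pairwise independence is extracted from the family by restricting to two
      disjoint singletons and then projecting.\<close>
    have "indep_var (PiM {i} (\<lambda>_. borel)) (\<lambda>\<omega>. restrict (\<lambda>i. X i \<omega>) {i})
        (PiM {j} (\<lambda>_. borel)) (\<lambda>\<omega>. restrict (\<lambda>i. X i \<omega>) {j})"
      using ij by (intro indep_var_restrict[OF indep]) auto
    then have "indep_var borel ((\<lambda>f. f i) \<circ> (\<lambda>\<omega>. restrict (\<lambda>i. X i \<omega>) {i}))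
       borel ((\<lambda>f. f j) \<circ> (\<lambda>\<omega>. restrict (\<lambda>i. X i \<omega>) {j}))"
      by (rule indep_var_compose) (auto intro!: measurable_component_singleton)
    then have "indep_var borel (X i) borel (X j)" by (simp add: comp_def)
    then have eq: "distr M borel (X i) \<Otimes>\<^sub>M distr M borel (X j) = distr M (borel \<Otimes>\<^sub>M borel) (\<lambda>\<omega>. (X i \<omega>, X j \<omega>))"
      unfolding indep_var_distribution_eq by blast
    interpret Dj: prob_space "distr M borel (X j)" by (rule prob_space_distr) simp
    let ?D = "{p :: real \<times> real. fst p = snd p}"
    have D: "?D \<in> sets (borel \<Otimes>\<^sub>M borel)"
      unfolding borel_prod by (intro borel_closed closed_Collect_eq continuous_intros)
    have s: "sets (distr M borel (X i) \<Otimes>\<^sub>M distr M borel (X j)) = sets (borel \<Otimes>\<^sub>M borel)"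
      by (intro sets_pair_measure_cong) auto
    have "emeasure M {\<omega> \<in> space M. X i \<omega> = X j \<omega>} = emeasure (distr M (borel \<Otimes>\<^sub>M borel) (\<lambda>\<omega>. (X i \<omega>, X j \<omega>))) ?D"
      using D by (subst emeasure_distr) (auto intro!: arg_cong[of _ _ "emeasure M"])
    also have "\<dots> = (\<integral>\<^sup>+x. emeasure (distr M borel (X j)) (Pair x -` ?D) \<partial>distr M borel (X i))"
      unfolding eq[symmetric] using D s by (intro Dj.emeasure_pair_measure_alt) simp
    also have "\<dots> = (\<integral>\<^sup>+x. 0 \<partial>distr M borel (X i))"
    proof (rule nn_integral_cong)
      fix x
      have "emeasure (distr M borel (X j)) (Pair x -` ?D) = emeasure M {\<omega> \<in> space M. X j \<omega> = x}"
        by (subst emeasure_distr) (auto intro!: arg_cong[of _ _ "emeasure M"])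
      then show "emeasure (distr M borel (X j)) (Pair x -` ?D) = 0"
        by (simp add: emeasure_eq_measure atom)
    qed
    finally have "prob {\<omega> \<in> space M. X i \<omega> = X j \<omega>} = 0" by (simp add: emeasure_eq_measure)
    then show ?thesis by (subst (asm) prob_eq_0) auto
  qed
  then have "AE \<omega> in M. \<forall>i j. i \<noteq> j \<longrightarrow> X i \<omega> \<noteq> X j \<omega>"
    by (simp add: AE_all_countable)
  then show ?thesis by eventually_elim (auto simp: inj_def)
qed

end

section \<open>Empirical distribution functions compared with the copula\<close>

text \<open>Evaluating the empirical measure of the transformed points \<open>(F (x i), G (y i))\<close> only on the
  grid \<open>(k / n, l / n)\<close> suffices by monotonicity.\<close>
lemma emp_joint_df_close_of_grid:
  fixes F G :: "real \<Rightarrow> real"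
  assumes A: "is_copula A" and F: "mono F" "\<And>t. F t \<in> {0..1}" and G: "mono G" "\<And>t. G t \<in> {0..1}"
    and n: "n \<ge> 1"
    and grid: "\<And>(k :: nat) (l :: nat). k \<le> n \<Longrightarrow> l \<le> n \<Longrightarrow>
      \<bar>(\<Sum>i<n. of_bool (F (x i) \<le> k / n \<and> G (y i) \<le> l / n)) / n - A (k / n) (l / n)\<bar> \<le> \<epsilon>"
  shows "\<bar>emp_joint_df x y n s t - A (F s) (G t)\<bar> \<le> \<epsilon> + 2 / n"
proof -
  let ?C = "\<lambda>a b. (\<Sum>i<n. of_bool (F (x i) \<le> a \<and> G (y i) \<le> b)) / n"
  have np: "real n > 0" using n by simp
  have emp: "emp_joint_df x y n s t = (\<Sum>i<n. of_bool (x i \<le> s \<and> y i \<le> t)) / n"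
    unfolding emp_joint_df_eq_sum of_bool_conj ..
  \<comment> \<open>The grid index is the ceiling of n * a. Since \<open>k - 1\<close> is truncated
    at 0, its properties are claimed for k \<ge> 1 only; k = 0 happens only for a = 0.\<close>
  have ceil: "\<exists>k\<le>n. a \<le> real k / n \<and> (k \<ge> 1 \<longrightarrow> real (k - 1) / n < a) \<and> \<bar>real k / n - a\<bar> \<le> 1 / n
      \<and> (k \<ge> 1 \<longrightarrow> \<bar>real (k - 1) / n - a\<bar> \<le> 1 / n) \<and> (k = 0 \<longrightarrow> a = 0)"
    if a: "a \<in> {0..1}" for a :: real
  proof (rule exI[of _ "nat \<lceil>n * a\<rceil>"])
    define k where "k = nat \<lceil>n * a\<rceil>"
    have na: "0 \<le> n * a" "n * a \<le> n" using a np by (auto simp: mult_le_cancel_left2)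
    then have k: "n * a \<le> real k" "real k < n * a + 1" "k \<le> n"
      by (auto simp: k_def ceiling_le_iff nat_le_iff) linarith+
    have "real k / n < (n * a + 1) / n" using k np by (intro divide_strict_right_mono) auto
    then have 1: "a \<le> real k / n" "real k / n < a + 1 / n"
      using k np by (auto simp: pos_le_divide_eq add_divide_distrib mult.commute)
    have 2: "real (k - 1) / n = real k / n - 1 / n" if "k \<ge> 1"
      using that by (simp add: of_nat_diff diff_divide_distrib)
    have 3: "k = 0 \<longrightarrow> a = 0" using 1 a by auto
    show "nat \<lceil>n * a\<rceil> \<le> n \<and> a \<le> real (nat \<lceil>n * a\<rceil>) / n \<and> (nat \<lceil>n * a\<rceil> \<ge> 1 \<longrightarrow> real (nat \<lceil>n * a\<rceil> - 1) / n < a) \<and>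
      \<bar>real (nat \<lceil>n * a\<rceil>) / n - a\<bar> \<le> 1 / n \<and> (nat \<lceil>n * a\<rceil> \<ge> 1 \<longrightarrow> \<bar>real (nat \<lceil>n * a\<rceil> - 1) / n - a\<bar> \<le> 1 / n) \<and>
      (nat \<lceil>n * a\<rceil> = 0 \<longrightarrow> a = 0)"
      unfolding k_def[symmetric] using k 1 2 3 by (smt (verit))
  qed
  obtain k where k: "k \<le> n" "F s \<le> real k / n" "k \<ge> 1 \<longrightarrow> real (k - 1) / n < F s" "\<bar>real k / n - F s\<bar> \<le> 1 / n"
      "k \<ge> 1 \<longrightarrow> \<bar>real (k - 1) / n - F s\<bar> \<le> 1 / n" "k = 0 \<longrightarrow> F s = 0"
    using ceil[OF F(2)[of s]] by blast
  obtain l where l: "l \<le> n" "G t \<le> real l / n" "l \<ge> 1 \<longrightarrow> real (l - 1) / n < G t" "\<bar>real l / n - G t\<bar> \<le> 1 / n"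
      "l \<ge> 1 \<longrightarrow> \<bar>real (l - 1) / n - G t\<bar> \<le> 1 / n" "l = 0 \<longrightarrow> G t = 0"
    using ceil[OF G(2)[of t]] by blast
  have unit: "real m / n \<in> {0..1}" if "m \<le> n" for m using that np by auto
  have "emp_joint_df x y n s t \<le> ?C (k / n) (l / n)"
    unfolding emp
  proof (intro divide_right_mono sum_mono)
    fix i
    have "F (x i) \<le> F s" if "x i \<le> s" using monoD[OF F(1) that] .
    moreover have "G (y i) \<le> G t" if "y i \<le> t" using monoD[OF G(1) that] .
    ultimately show "of_bool (x i \<le> s \<and> y i \<le> t) \<le> (of_bool (F (x i) \<le> k / n \<and> G (y i) \<le> l / n) :: real)"
      using k(2) l(2) by force
  qed simp
  moreover have "\<bar>A (k / n) (l / n) - A (F s) (G t)\<bar> \<le> \<bar>k / n - F s\<bar> + \<bar>l / n - G t\<bar>"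
    using k l by (intro copula_lipschitz A F G unit)
  ultimately have upper: "emp_joint_df x y n s t \<le> A (F s) (G t) + (\<epsilon> + 2 / n)"
    using grid[OF k(1) l(1)] k(4) l(4) by linarith
  have lower: "A (F s) (G t) - (\<epsilon> + 2 / n) \<le> emp_joint_df x y n s t"
  \<comment> \<open>Without a lower grid neighbour one margin vanishes, so the copula value is 0 and
    the bound is trivial.\<close>
  proof (cases "k = 0 \<or> l = 0")
    case True
    then have "A (F s) (G t) = 0" using k l A F(2)[of s] G(2)[of t] by (auto simp: is_copula_def)
    moreover have "\<epsilon> \<ge> 0" using grid[of 0 0] by linarith
    moreover have "0 \<le> emp_joint_df x y n s t" by (simp add: emp_joint_df_def)
    ultimately show ?thesis by (smt (verit) divide_nonneg_nonneg of_nat_0_le_iff)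
  next
    case False
    then have kl: "k \<ge> 1" "l \<ge> 1" by auto
    have "?C (real (k - 1) / n) (real (l - 1) / n) \<le> emp_joint_df x y n s t"
      unfolding emp
    proof (intro divide_right_mono sum_mono)
      fix i
      \<comment> \<open>\<open>F\<close> may be constant on intervals, so only a strict inequality
        can be pulled back; hence the strict bound on (k - 1)/n.\<close>
      have "x i \<le> s" if "F (x i) < F s" using monoD[OF F(1), of s "x i"] that by (cases "x i \<le> s") auto
      moreover have "y i \<le> t" if "G (y i) < G t" using monoD[OF G(1), of t "y i"] that by (cases "y i \<le> t") auto
      ultimately show "of_bool (F (x i) \<le> real (k - 1) / n \<and> G (y i) \<le> real (l - 1) / n) \<le>
          (of_bool (x i \<le> s \<and> y i \<le> t) :: real)"
        using k(3) l(3) kl by force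
    qed simp
    moreover have "\<bar>A (real (k - 1) / n) (real (l - 1) / n) - A (F s) (G t)\<bar> \<le>
        \<bar>real (k - 1) / n - F s\<bar> + \<bar>real (l - 1) / n - G t\<bar>"
      using k l by (intro copula_lipschitz A F G unit) auto
    moreover have "\<bar>?C (real (k - 1) / n) (real (l - 1) / n) - A (real (k - 1) / n) (real (l - 1) / n)\<bar> \<le> \<epsilon>"
      using k l by (intro grid) auto
    moreover have "\<bar>real (k - 1) / n - F s\<bar> \<le> 1 / n" "\<bar>real (l - 1) / n - G t\<bar> \<le> 1 / n" using k l kl by auto
    ultimately show ?thesis by linarith
  qed
  from upper lower show ?thesis by (simp add: abs_le_iff)
qed

text \<open>For t beyond all observed y-values the joint empirical function equals the marginal one.
  Taking t also so large that G t is within 1/n of 1 costs 1/n on the copula side.\<close>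

lemma emp_df_close_of_joint:
  fixes F G :: "real \<Rightarrow> real"
  assumes A: "is_copula A" and F: "\<And>t. F t \<in> {0..1}" and G: "\<And>t. G t \<in> {0..1}"
    and G1: "(G \<longlongrightarrow> 1) at_top" and n: "n \<ge> 1"
    and H: "\<And>t. \<bar>emp_joint_df x y n s t - A (F s) (G t)\<bar> \<le> \<delta>"
  shows "\<bar>emp_df x n s - F s\<bar> \<le> \<delta> + 1 / n"
proof -
  have "\<forall>\<^sub>F t in at_top. G t > 1 - 1 / n" using n by (intro order_tendstoD(1)[OF G1]) auto
  moreover have "\<forall>\<^sub>F t in at_top. \<forall>i<n. y i \<le> t"
  proof -
    have "\<forall>\<^sub>F t in at_top. \<forall>i\<in>{..<n}. y i \<le> t"
      by (intro eventually_ball_finite) (auto simp: eventually_ge_at_top)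
    then show ?thesis by (rule eventually_mono) auto
  qed
  ultimately have "\<forall>\<^sub>F t in at_top. G t > 1 - 1 / n \<and> (\<forall>i<n. y i \<le> t)" by (rule eventually_conj)
  then obtain t where t: "G t > 1 - 1 / n" "\<forall>i<n. y i \<le> t"
    using eventually_happens'[OF trivial_limit_at_top_linorder] by blast
  have "{i. i < n \<and> x i \<le> s \<and> y i \<le> t} = {i. i < n \<and> x i \<le> s}" using t(2) by auto
  then have "emp_joint_df x y n s t = emp_df x n s" by (simp add: emp_joint_df_def emp_df_def)
  moreover have "\<bar>A (F s) (G t) - A (F s) 1\<bar> \<le> \<bar>F s - F s\<bar> + \<bar>G t - 1\<bar>"
    by (intro copula_lipschitz A F G) auto
  moreover have "A (F s) 1 = F s" using A F[of s] by (auto simp: is_copula_def)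
  moreover have "\<bar>G t - 1\<bar> \<le> 1 / n" using t(1) G[of t] by auto
  ultimately show ?thesis using H[of t] by simp
qed

text \<open>Exchanging the coordinates makes the marginal estimate for X available for Y.\<close>

lemma emp_joint_df_swap: "emp_joint_df y x n t s = emp_joint_df x y n s t"
  unfolding emp_joint_df_eq_sum by (intro arg_cong2[of _ _ _ _ "(/)"] sum.cong refl mult.commute)

lemma is_copula_swap: "is_copula A \<Longrightarrow> is_copula (\<lambda>u v. A v u)"
proof -
  assume A: "is_copula A"
  have "A v2 u2 - A v2 u1 - A v1 u2 + A v1 u1 \<ge> 0"
    if "u1 \<in> {0..1}" "u2 \<in> {0..1}" "v1 \<in> {0..1}" "v2 \<in> {0..1}" "u1 \<le> u2" "v1 \<le> v2" for u1 u2 v1 v2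
    using copula_rect_nonneg[OF A, of v1 v2 u1 u2] that by auto
  moreover have "\<forall>u\<in>{0..1}. A 0 u = 0 \<and> A u 0 = 0 \<and> A 1 u = u \<and> A u 1 = u"
    using A by (auto simp: is_copula_def)
  ultimately show ?thesis unfolding is_copula_def by blast
qed

section \<open>Almost sure convergence for samples of a copula\<close>

locale copula_sample = prob_space M for M :: "'a measure" +
  fixes X Y :: "nat \<Rightarrow> 'a \<Rightarrow> real" and A :: "real \<Rightarrow> real \<Rightarrow> real"
  assumes meas [measurable]: "\<And>i. X i \<in> borel_measurable M" "\<And>i. Y i \<in> borel_measurable M"
    and indep: "indep_vars (\<lambda>_. borel :: (real \<times> real) measure) (\<lambda>i \<omega>. (X i \<omega>, Y i \<omega>)) UNIV"
    and ident: "\<And>i. distr M borel (\<lambda>\<omega>. (X i \<omega>, Y i \<omega>)) = distr M borel (\<lambda>\<omega>. (X 0 \<omega>, Y 0 \<omega>))"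
    and H_cont: "continuous_on UNIV (\<lambda>(a, b). prob {\<omega> \<in> space M. X 0 \<omega> \<le> a \<and> Y 0 \<omega> \<le> b})"
    and A_cop: "is_copula A"
    and sklar: "\<And>a b. prob {\<omega> \<in> space M. X 0 \<omega> \<le> a \<and> Y 0 \<omega> \<le> b} =
                 A (prob {\<omega> \<in> space M. X 0 \<omega> \<le> a}) (prob {\<omega> \<in> space M. Y 0 \<omega> \<le> b})"
begin

definition F :: "real \<Rightarrow> real" where "F t = prob {\<omega> \<in> space M. X 0 \<omega> \<le> t}"
definition G :: "real \<Rightarrow> real" where "G t = prob {\<omega> \<in> space M. Y 0 \<omega> \<le> t}"

lemma meas_pair [measurable]: "(\<lambda>\<omega>. (X i \<omega>, Y i \<omega>)) \<in> borel_measurable M"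
  unfolding borel_prod[symmetric] by simp

lemma prob_pair_ident:
  assumes "S \<in> sets (borel :: (real \<times> real) measure)"
  shows "prob {\<omega> \<in> space M. (X i \<omega>, Y i \<omega>) \<in> S} = prob {\<omega> \<in> space M. (X 0 \<omega>, Y 0 \<omega>) \<in> S}"
proof -
  have "prob {\<omega> \<in> space M. (X i \<omega>, Y i \<omega>) \<in> S} = measure (distr M borel (\<lambda>\<omega>. (X i \<omega>, Y i \<omega>))) S" for i
  proof -
    have "(\<lambda>\<omega>. (X i \<omega>, Y i \<omega>)) -` S \<inter> space M = {\<omega> \<in> space M. (X i \<omega>, Y i \<omega>) \<in> S}" by auto
    then show ?thesis using assms by (simp add: measure_distr)
  qed
  then show ?thesis by (simp add: ident[of i])
qed

lemma atom_X: "prob {\<omega> \<in> space M. X i \<omega> = a} = 0"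
proof -
  have "continuous_on UNIV (\<lambda>a. prob {\<omega> \<in> space M. X 0 \<omega> \<le> a \<and> Y 0 \<omega> \<le> b})" for b
  proof -
    have "continuous_on UNIV (\<lambda>a :: real. case (a, b) of (a, b) \<Rightarrow> prob {\<omega> \<in> space M. X 0 \<omega> \<le> a \<and> Y 0 \<omega> \<le> b})"
      by (rule continuous_on_compose2[OF H_cont]) (auto intro!: continuous_intros)
    then show ?thesis by simp
  qed
  then have "prob {\<omega> \<in> space M. X 0 \<omega> = a} = 0"
    by (rule no_atom_of_joint_continuous[OF meas])
  moreover have "{p :: real \<times> real. fst p = a} \<in> sets borel"
    by (intro borel_closed closed_Collect_eq continuous_intros)
  ultimately show ?thesis using prob_pair_ident[of "{p. fst p = a}" i] by simp
qed

lemma atom_Y: "prob {\<omega> \<in> space M. Y i \<omega> = a} = 0"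
proof -
  have "continuous_on UNIV (\<lambda>a. prob {\<omega> \<in> space M. Y 0 \<omega> \<le> a \<and> X 0 \<omega> \<le> b})" for b
  proof -
    have "continuous_on UNIV (\<lambda>a :: real. case (b, a) of (b, a) \<Rightarrow> prob {\<omega> \<in> space M. X 0 \<omega> \<le> b \<and> Y 0 \<omega> \<le> a})"
      by (rule continuous_on_compose2[OF H_cont]) (auto intro!: continuous_intros)
    then show ?thesis by (simp add: conj_commute)
  qed
  then have "prob {\<omega> \<in> space M. Y 0 \<omega> = a} = 0"
    by (rule no_atom_of_joint_continuous[OF meas(2) meas(1)])
  moreover have "{p :: real \<times> real. snd p = a} \<in> sets borel"
    by (intro borel_closed closed_Collect_eq continuous_intros)
  ultimately show ?thesis using prob_pair_ident[of "{p. snd p = a}" i] by simp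
qed

lemma F_props: "mono F" "isCont F t" "(F \<longlongrightarrow> 1) at_top" "(F \<longlongrightarrow> 0) at_bot"
  and G_props: "mono G" "isCont G t" "(G \<longlongrightarrow> 1) at_top" "(G \<longlongrightarrow> 0) at_bot"
  unfolding F_def[abs_def] G_def[abs_def]
  by (rule cdf_properties[OF meas(1)[of 0] atom_X] cdf_properties[OF meas(2)[of 0] atom_Y])+

lemma F_unit: "F t \<in> {0..1}" and G_unit: "G t \<in> {0..1}"
  by (auto simp: F_def G_def)

lemma FG_measurable [measurable]: "F \<in> borel_measurable borel" "G \<in> borel_measurable borel"
  by (intro borel_measurable_mono F_props G_props)+

lemma prob_transform_X: "a \<in> {0..1} \<Longrightarrow> prob {\<omega> \<in> space M. F (X 0 \<omega>) \<le> a} = a"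
  using prob_integral_transform[OF meas(1)[of 0] atom_X, of a] by (simp only: F_def)

lemma prob_transform_Y: "a \<in> {0..1} \<Longrightarrow> prob {\<omega> \<in> space M. G (Y 0 \<omega>) \<le> a} = a"
  using prob_integral_transform[OF meas(2)[of 0] atom_Y, of a] by (simp only: G_def)

text \<open>At interior levels quantiles rewrite the event as {X \<le> q, Y \<le> r}, and Sklar's
  relation gives the value. At boundary levels, where quantiles may not exist, the uniform margins
  decide.\<close>

lemma joint_transform:
  assumes "a \<in> {0..1}" "b \<in> {0..1}"
  shows "prob {\<omega> \<in> space M. F (X 0 \<omega>) \<le> a \<and> G (Y 0 \<omega>) \<le> b} = A a b"
proof -
  have A: "A 0 b = 0" "A a 0 = 0" "A 1 b = b" "A a 1 = a" using A_cop assms by (auto simp: is_copula_def)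
  have le: "prob {\<omega> \<in> space M. F (X 0 \<omega>) \<le> a \<and> G (Y 0 \<omega>) \<le> b} \<le> a"
    "prob {\<omega> \<in> space M. F (X 0 \<omega>) \<le> a \<and> G (Y 0 \<omega>) \<le> b} \<le> b"
  proof -
    have "prob {\<omega> \<in> space M. F (X 0 \<omega>) \<le> a \<and> G (Y 0 \<omega>) \<le> b} \<le> prob {\<omega> \<in> space M. F (X 0 \<omega>) \<le> a}"
      "prob {\<omega> \<in> space M. F (X 0 \<omega>) \<le> a \<and> G (Y 0 \<omega>) \<le> b} \<le> prob {\<omega> \<in> space M. G (Y 0 \<omega>) \<le> b}"
      by (intro finite_measure_mono; auto)+
    then show "prob {\<omega> \<in> space M. F (X 0 \<omega>) \<le> a \<and> G (Y 0 \<omega>) \<le> b} \<le> a"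
      "prob {\<omega> \<in> space M. F (X 0 \<omega>) \<le> a \<and> G (Y 0 \<omega>) \<le> b} \<le> b"
      by (simp_all only: prob_transform_X[OF assms(1)] prob_transform_Y[OF assms(2)])
  qed
  consider "a = 0" | "b = 0" | "a = 1" | "b = 1" | "0 < a" "a < 1" "0 < b" "b < 1"
    using assms by fastforce
  then show ?thesis
  proof cases
    case 1
    then show ?thesis using le(1) A(1) by (simp add: measure_le_0_iff)
  next
    case 2
    then show ?thesis using le(2) A(2) by (simp add: measure_le_0_iff)
  next
    case 3
    then have "{\<omega> \<in> space M. F (X 0 \<omega>) \<le> a \<and> G (Y 0 \<omega>) \<le> b} = {\<omega> \<in> space M. G (Y 0 \<omega>) \<le> b}"
      using F_unit by auto
    then show ?thesis using prob_transform_Y[OF assms(2)] A(3) 3 by simp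
  next
    case 4
    then have "{\<omega> \<in> space M. F (X 0 \<omega>) \<le> a \<and> G (Y 0 \<omega>) \<le> b} = {\<omega> \<in> space M. F (X 0 \<omega>) \<le> a}"
      using G_unit by auto
    then show ?thesis using prob_transform_X[OF assms(1)] A(4) 4 by simp
  next
    case 5
    show ?thesis
    proof (rule cdf_quantile[OF meas(1)[of 0] atom_X 5(1,2)], fold F_def)
      fix q assume q: "F q = a" "\<And>t. F t \<le> a \<longleftrightarrow> t \<le> q"
      show ?thesis
      proof (rule cdf_quantile[OF meas(2)[of 0] atom_Y 5(3,4)], fold G_def)
        fix r assume r: "G r = b" "\<And>t. G t \<le> b \<longleftrightarrow> t \<le> r"
        show ?thesis
          unfolding q(2) r(2) sklar F_def[symmetric] G_def[symmetric] q(1) r(1) ..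
      qed
    qed
  qed
qed

text \<open>The sample itself provides the measure that \<open>dsm A\<close> describes.\<close>

lemma is_dsm_copula: "is_dsm A (distr M borel (\<lambda>\<omega>. (F (X 0 \<omega>), G (Y 0 \<omega>))))"
proof -
  let ?T = "\<lambda>\<omega>. (F (X 0 \<omega>), G (Y 0 \<omega>))"
  have T [measurable]: "?T \<in> borel_measurable M"
    unfolding borel_prod[symmetric] by simp
  interpret D: prob_space "distr M borel ?T" by (rule prob_space_distr) simp
  have "emeasure (distr M borel ?T) (UNIV - {0..1} \<times> {0..1}) = emeasure M (?T -` (UNIV - {0..1} \<times> {0..1}) \<inter> space M)"
    by (intro emeasure_distr T borel_open open_Diff open_UNIV closed_Times closed_atLeastAtMost)
  also have "?T -` (UNIV - {0..1} \<times> {0..1}) \<inter> space M = {}"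
    using F_unit G_unit by fastforce
  finally have "emeasure (distr M borel ?T) (UNIV - {0..1} \<times> {0..1}) = 0" by simp
  moreover have "measure (distr M borel ?T) ({0..a} \<times> {0..b}) = A a b" if "a \<in> {0..1}" "b \<in> {0..1}" for a b
  proof -
    have "measure (distr M borel ?T) ({0..a} \<times> {0..b}) = prob (?T -` ({0..a} \<times> {0..b}) \<inter> space M)"
      by (intro measure_distr T borel_closed closed_Times closed_atLeastAtMost)
    also have "?T -` ({0..a} \<times> {0..b}) \<inter> space M = {\<omega> \<in> space M. F (X 0 \<omega>) \<le> a \<and> G (Y 0 \<omega>) \<le> b}"
      using F_unit G_unit by auto
    finally show ?thesis using joint_transform[OF that] by simp
  qed
  ultimately show ?thesis using D.finite_measure_axioms by (simp add: is_dsm_def)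
qed

text \<open>The empirical distribution function of the unobservable scores (F(X_i), G(Y_i)); at
  fixed (a, b) it is a mean of i.i.d. indicators with expectation \<open>A a b\<close>, whatever the
  margins.\<close>

definition transformed_df :: "nat \<Rightarrow> 'a \<Rightarrow> real \<Rightarrow> real \<Rightarrow> real" where
  "transformed_df n \<omega> a b = (\<Sum>i<n. of_bool (F (X i \<omega>) \<le> a \<and> G (Y i \<omega>) \<le> b)) / n"

lemma transformed_df_measurable [measurable]: "(\<lambda>\<omega>. transformed_df n \<omega> a b) \<in> borel_measurable M"
  unfolding transformed_df_def by measurable

lemma transformed_df_tail:
  assumes ab: "a \<in> {0..1}" "b \<in> {0..1}" and n: "n \<ge> 1" and \<epsilon>: "\<epsilon> \<ge> 0"
  shows "prob {\<omega> \<in> space M. \<bar>transformed_df n \<omega> a b - A a b\<bar> \<ge> \<epsilon>} \<le> 2 * exp (- 2 * real n * \<epsilon>\<^sup>2)"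
proof -
  let ?S = "{p :: real \<times> real. F (fst p) \<le> a \<and> G (snd p) \<le> b}"
  let ?f = "\<lambda>p :: real \<times> real. of_bool (F (fst p) \<le> a \<and> G (snd p) \<le> b) :: real"
  let ?Z = "\<lambda>i \<omega>. of_bool (F (X i \<omega>) \<le> a \<and> G (Y i \<omega>) \<le> b) :: real"
  have S: "?S \<in> sets borel"
  proof -
    have "{p \<in> space (borel \<Otimes>\<^sub>M borel). F (fst p) \<le> a \<and> G (snd p) \<le> b} \<in> sets (borel \<Otimes>\<^sub>M borel)"
      by measurable
    then show ?thesis by (simp add: space_pair_measure flip: borel_prod)
  qed
  have f: "?f \<in> borel_measurable borel"
  proof -
    have "?f = indicator ?S" by (auto simp: fun_eq_iff indicator_def)
    then show ?thesis using S by simp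
  qed
  have ind: "indep_vars (\<lambda>_. borel) ?Z UNIV"
    using indep_vars_compose2[OF indep f] by simp
  have E: "expectation (?Z i) = A a b" for i
  proof -
    have "expectation (?Z i) = expectation (indicator {\<omega> \<in> space M. (X i \<omega>, Y i \<omega>) \<in> ?S})"
      by (intro Bochner_Integration.integral_cong) (auto simp: indicator_def)
    also have "\<dots> = prob {\<omega> \<in> space M. (X i \<omega>, Y i \<omega>) \<in> ?S}"
      by simp
    also have "\<dots> = prob {\<omega> \<in> space M. (X 0 \<omega>, Y 0 \<omega>) \<in> ?S}"
      by (rule prob_pair_ident[OF S])
    also have "\<dots> = A a b"
      using joint_transform[OF ab] by simp
    finally show ?thesis .
  qed
  interpret Hoeffding_ineq M "{..<n}" ?Z "\<lambda>_. 0" "\<lambda>_. 1" "real n * A a b"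
  proof unfold_locales
    show "indep_vars (\<lambda>_. borel) ?Z {..<n}" using ind by (rule indep_vars_subset) simp
    show "real n * A a b \<equiv> \<Sum>i<n. expectation (?Z i)" by (simp add: E)
  qed (auto simp: E)
  have np: "real n > 0" using n by simp
  have "prob {\<omega> \<in> space M. \<bar>transformed_df n \<omega> a b - A a b\<bar> \<ge> \<epsilon>} =
      prob {\<omega> \<in> space M. \<bar>(\<Sum>i<n. ?Z i \<omega>) - real n * A a b\<bar> \<ge> n * \<epsilon>}"
  proof -
    have "\<bar>z / n - A a b\<bar> \<ge> \<epsilon> \<longleftrightarrow> \<bar>z - n * A a b\<bar> \<ge> n * \<epsilon>" for z :: real
    proof -
      have "z / n - A a b = (z - n * A a b) / n" using np by (simp add: field_simps)
      then have "\<bar>z / n - A a b\<bar> = \<bar>z - n * A a b\<bar> / n" by (simp add: abs_divide)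
      then show ?thesis using np by (simp add: pos_le_divide_eq mult.commute)
    qed
    then show ?thesis by (simp only: transformed_df_def)
  qed
  \<comment> \<open>The n indicators have range 1 each, so the squared ranges add up to n and cancel
    one factor of the squared deviation n * \<open>\<epsilon>\<close>.\<close>
  also have "\<dots> \<le> 2 * exp (- 2 * (n * \<epsilon>)\<^sup>2 / (\<Sum>i<n. (1 - 0)\<^sup>2))"
    using np \<epsilon> by (intro Hoeffding_ineq_abs_ge) auto
  also have "- 2 * (n * \<epsilon>)\<^sup>2 / (\<Sum>i<n. (1 - 0)\<^sup>2) = - 2 * real n * \<epsilon>\<^sup>2"
    using np by (simp add: power2_eq_square)
  finally show ?thesis .
qed

text \<open>The union bound over (n + 1)^2 grid points is harmless: with deviation n powr -t the
  exponent is of order n powr (1 - 2t). For t < 1/2 this power is positive and the exponential beats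
  every polynomial.\<close>

lemma transformed_df_rate:
  assumes t: "0 < t" "t < 1 / 2"
  shows "AE \<omega> in M. \<forall>\<^sub>F n in sequentially. \<forall>k\<le>n. \<forall>l\<le>n.
    \<bar>transformed_df n \<omega> (k / n) (l / n) - A (k / n) (l / n)\<bar> \<le> n powr - t"
proof -
  define B where "B k l n = {\<omega> \<in> space M. \<bar>transformed_df n \<omega> (real k / real n) (real l / real n) -
      A (real k / real n) (real l / real n)\<bar> \<ge> real n powr - t}" for k l n
  define E where "E n = (\<Union>k\<le>n. \<Union>l\<le>n. B k l n)" for n
  have B [measurable]: "B k l n \<in> events" for k l n unfolding B_def by measurable
  have E: "E n \<in> events" for n unfolding E_def by measurable
  have bound: "prob (E n) \<le> (real n + 1)\<^sup>2 * (2 * exp (- 2 * real n powr (1 - 2 * t)))" if n: "n \<ge> 1" for n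
  proof -
    have "prob (E n) \<le> (\<Sum>k\<le>n. prob (\<Union>l\<le>n. B k l n))"
      unfolding E_def by (intro finite_measure_subadditive_finite) auto
    also have "\<dots> \<le> (\<Sum>k\<le>n. \<Sum>l\<le>n. prob (B k l n))"
      by (intro sum_mono finite_measure_subadditive_finite) auto
    also have "\<dots> \<le> (\<Sum>k\<le>n. \<Sum>l\<le>n. 2 * exp (- 2 * real n powr (1 - 2 * t)))"
    proof (intro sum_mono)
      fix k l assume "k \<in> {..n}" "l \<in> {..n}"
      then have "real k / n \<in> {0..1}" "real l / n \<in> {0..1}" using n by auto
      then have "prob (B k l n) \<le> 2 * exp (- 2 * real n * (n powr - t)\<^sup>2)"
        unfolding B_def using n by (intro transformed_df_tail) auto
      also have "- 2 * real n * (real n powr - t)\<^sup>2 = - 2 * real n powr (1 - 2 * t)"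
      proof -
        have "real n * (real n powr - t)\<^sup>2 = n powr 1 * n powr (- 2 * t)"
          using n by (simp add: power2_eq_square powr_add[symmetric])
        also have "\<dots> = n powr (1 - 2 * t)" by (simp only: powr_add[symmetric]) simp
        finally show ?thesis by simp
      qed
      finally show "prob (B k l n) \<le> 2 * exp (- 2 * real n powr (1 - 2 * t))" .
    qed
    also have "\<dots> = (real n + 1)\<^sup>2 * (2 * exp (- 2 * real n powr (1 - 2 * t)))"
      by (simp add: power2_eq_square algebra_simps)
    finally show ?thesis .
  qed
  have "summable (\<lambda>n. prob (E n))"
  proof (rule summable_comparison_test_bigo)
    show "summable (\<lambda>n. norm (1 / real n ^ 2))"
      using inverse_power_summable[of 2, where 'a = real] by (simp add: field_simps)
    have c: "1 - 2 * t > 0" using t by simp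
    have "(\<lambda>n. prob (E n)) \<in> O(\<lambda>n. (real n + 1)\<^sup>2 * (2 * exp (- 2 * real n powr (1 - 2 * t))))"
      using bound by (intro landau_o.big_mono eventually_mono[OF eventually_ge_at_top[of 1]]) auto
    also have "(\<lambda>n::nat. (real n + 1)\<^sup>2 * (2 * exp (- 2 * real n powr (1 - 2 * t)))) \<in> O(\<lambda>n. 1 / real n ^ 2)"
      using c by real_asymp
    finally show "(\<lambda>n. prob (E n)) \<in> O(\<lambda>n. 1 / real n ^ 2)" .
  qed
  then have "AE \<omega> in M. \<forall>\<^sub>F n in sequentially. \<omega> \<in> space M - E n"
    using E by (intro borel_cantelli_AE1) (auto simp: emeasure_eq_measure)
  then show ?thesis
  proof eventually_elim
    case (elim \<omega>)
    then show ?case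
    proof eventually_elim
      case (elim n)
      show ?case
      proof (intro allI impI)
        fix k l assume "k \<le> n" "l \<le> n"
        then have "\<omega> \<notin> B k l n" using elim by (auto simp: E_def)
        then show "\<bar>transformed_df n \<omega> (k / n) (l / n) - A (k / n) (l / n)\<bar> \<le> n powr - t"
          using elim by (auto simp: B_def)
      qed
    qed
  qed
qed

lemma no_ties: "AE \<omega> in M. inj (\<lambda>i. X i \<omega>) \<and> inj (\<lambda>i. Y i \<omega>)"
proof -
  have "indep_vars (\<lambda>_. borel) X UNIV" "indep_vars (\<lambda>_. borel) Y UNIV"
    using indep_vars_compose2[OF indep, of "\<lambda>_. fst" "\<lambda>_. borel"]
      indep_vars_compose2[OF indep, of "\<lambda>_. snd" "\<lambda>_. borel"]
    unfolding borel_prod[symmetric] by simp_all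
  from this[THEN indep_no_ties] show ?thesis using atom_X atom_Y by auto
qed

text \<open>The quantifiers over x and y stand inside the almost sure statement: absence of ties and
  the grid rate fix one good event that serves all arguments.\<close>

lemma cb_kernel_converges:
  assumes K: "is_continuous_markov_kernel A K" and s: "0 < s" "s < 1 / 2"
  shows "AE \<omega> in M. \<forall>x y. (\<lambda>n. cb_kernel (nat \<lfloor>real n powr s\<rfloor>)
      (emp_copula (\<lambda>i. X i \<omega>) (\<lambda>i. Y i \<omega>) n) (emp_df (\<lambda>i. X i \<omega>) n x) (emp_df (\<lambda>i. Y i \<omega>) n y))
    \<longlonglongrightarrow> measure (K (F x)) {0..G y}"
proof -
  \<comment> \<open>The midpoint of s and 1/2: slow enough for the tail bound, fast enough to beat
    the resolution N.\<close>
  define t where "t = (s + 1 / 2) / 2"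
  have t: "0 < t" "t < 1 / 2" "s < t" using s by (auto simp: t_def)
  show ?thesis
    using no_ties transformed_df_rate[OF t(1,2)]
  proof eventually_elim
    case (elim \<omega>)
    define \<xi> where "\<xi> = (\<lambda>i. X i \<omega>)"
    define \<eta> where "\<eta> = (\<lambda>i. Y i \<omega>)"
    define N where "N n = nat \<lfloor>real n powr s\<rfloor>" for n :: nat
    \<comment> \<open>Of the 3/n, two come from leaving the grid for the joint function and one from
      passing to a margin.\<close>
    define \<delta> where "\<delta> n = real n powr - t + 3 / real n" for n :: nat
    have inj: "inj_on \<xi> {..<n}" "inj_on \<eta> {..<n}" for n
      using elim(1) by (auto simp: \<xi>_def \<eta>_def intro: inj_on_subset)
    have close: "\<forall>\<^sub>F n in sequentially. n \<ge> 1 \<and> (\<forall>s t. \<bar>emp_joint_df \<xi> \<eta> n s t - A (F s) (G t)\<bar> \<le> \<delta> n) \<and>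
        (\<forall>s. \<bar>emp_df \<xi> n s - F s\<bar> \<le> \<delta> n) \<and> (\<forall>s. \<bar>emp_df \<eta> n s - G s\<bar> \<le> \<delta> n)"
      using elim(2) eventually_ge_at_top[of 1]
    proof eventually_elim
      case (elim n)
      have H: "\<bar>emp_joint_df \<xi> \<eta> n s t' - A (F s) (G t')\<bar> \<le> n powr - t + 2 / n" for s t'
        using elim
        by (intro emp_joint_df_close_of_grid A_cop F_props G_props F_unit G_unit)
          (auto simp: transformed_df_def \<xi>_def \<eta>_def)
      have "\<bar>emp_df \<xi> n s - F s\<bar> \<le> (n powr - t + 2 / n) + 1 / n" for s
        by (rule emp_df_close_of_joint[OF A_cop F_unit G_unit G_props(3) elim(2) H])
      moreover have "\<bar>emp_df \<eta> n s - G s\<bar> \<le> (n powr - t + 2 / n) + 1 / n" for s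
        by (rule emp_df_close_of_joint[where y = \<xi>, OF is_copula_swap[OF A_cop] G_unit F_unit F_props(3) elim(2)])
          (use H in \<open>simp add: emp_joint_df_swap[of \<eta> \<xi>]\<close>)
      moreover have "(n powr - t + 2 / n) + 1 / n = \<delta> n" by (simp add: \<delta>_def add_divide_distrib[symmetric])
      moreover have "\<bar>emp_joint_df \<xi> \<eta> n s t' - A (F s) (G t')\<bar> \<le> \<delta> n" for s t'
        by (rule order.trans[OF H]) (simp add: \<delta>_def divide_right_mono)
      ultimately show ?case using elim(2) by simp
    qed
    have \<delta>0: "\<delta> \<longlonglongrightarrow> 0" unfolding \<delta>_def using t by real_asymp
    have unit: "emp_df z n u \<in> {0..1}" for z n u
      using card_le_n[of n "\<lambda>i. z i \<le> u"] by (auto simp: emp_df_def divide_le_eq_1)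
    have lim: "(\<lambda>n. emp_df \<xi> n u) \<longlonglongrightarrow> F u" "(\<lambda>n. emp_df \<eta> n u) \<longlonglongrightarrow> G u" for u
    proof -
      have "(\<lambda>n. emp_df \<xi> n u - F u) \<longlonglongrightarrow> 0"
        using \<delta>0 by (rule Lim_null_comparison[rotated]) (use close in eventually_elim, auto)
      then show "(\<lambda>n. emp_df \<xi> n u) \<longlonglongrightarrow> F u" by (simp add: LIM_zero_iff)
      have "(\<lambda>n. emp_df \<eta> n u - G u) \<longlonglongrightarrow> 0"
        using \<delta>0 by (rule Lim_null_comparison[rotated]) (use close in eventually_elim, auto)
      then show "(\<lambda>n. emp_df \<eta> n u) \<longlonglongrightarrow> G u" by (simp add: LIM_zero_iff)
    qed
    have N: "filterlim N at_top sequentially"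
    proof -
      have "filterlim (\<lambda>n. real n powr s) at_top sequentially" using s by real_asymp
      then show ?thesis
        unfolding N_def
        by (intro filterlim_compose[OF filterlim_nat_sequentially] filterlim_compose[OF filterlim_floor_sequentially])
    qed
    \<comment> \<open>The product is at most n powr s times (3 n powr -t + 11/n), which vanishes
      because s < t and s < 1.\<close>
    have N\<delta>: "(\<lambda>n. N n * (3 * \<delta> n + 2 / n)) \<longlonglongrightarrow> 0"
    proof (rule Lim_null_comparison)
      show "(\<lambda>n. real n powr s * (3 * (real n powr - t + 3 / real n) + 2 / n)) \<longlonglongrightarrow> 0"
        using t s by real_asymp
      show "\<forall>\<^sub>F n in sequentially. norm (N n * (3 * \<delta> n + 2 / n)) \<le>
          real n powr s * (3 * (real n powr - t + 3 / real n) + 2 / n)"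
      proof (rule always_eventually, rule allI)
        fix n :: nat
        have "real (N n) \<le> real n powr s" unfolding N_def by simp
        then show "norm (N n * (3 * \<delta> n + 2 / n)) \<le> real n powr s * (3 * (real n powr - t + 3 / real n) + 2 / n)"
          unfolding \<delta>_def by (simp add: abs_mult mult_right_mono)
      qed
    qed
    show ?case
      unfolding \<xi>_def[symmetric] \<eta>_def[symmetric] N_def[symmetric]
    proof (intro allI)
      fix x y
      show "(\<lambda>n. cb_kernel (N n) (emp_copula \<xi> \<eta> n) (emp_df \<xi> n x) (emp_df \<eta> n y)) \<longlonglongrightarrow> measure (K (F x)) {0..G y}"
      proof (rule cb_kernel_tendsto[OF is_dsm_copula A_cop K F_unit G_unit])
        show "\<forall>\<^sub>F n in sequentially. is_dsm (emp_copula \<xi> \<eta> n) (density lborel (emp_density \<xi> \<eta> n))"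
          using close by eventually_elim (auto intro!: is_dsm_emp_copula inj)
        show "\<forall>\<^sub>F n in sequentially. \<forall>a\<in>{0..1}. emp_copula \<xi> \<eta> n a 0 = 0 \<and> emp_copula \<xi> \<eta> n 0 a = 0"
          using close by eventually_elim (use emp_copula_zero[OF inj] in blast)
        show "\<forall>\<^sub>F n in sequentially. \<forall>a\<in>{0..1}. \<forall>b\<in>{0..1}. \<bar>emp_copula \<xi> \<eta> n a b - A a b\<bar> \<le> 3 * \<delta> n + 2 / n"
          using close
        proof eventually_elim
          case (elim n)
          then show ?case
            using emp_copula_close[where \<delta> = "\<delta> n" and F = F and G = G, OF inj(1)[of n] inj(2)[of n] _ A_cop F_unit G_unit] by blast
        qed
      qed (use N N\<delta> lim unit in \<open>auto simp del: atLeastAtMost_iff\<close>)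
    qed
  qed
qed

end

theorem theorem5p6:
  fixes M :: "'a measure"
    and X Y :: "nat \<Rightarrow> 'a \<Rightarrow> real"
    and A :: "real \<Rightarrow> real \<Rightarrow> real"
    and K :: "real \<Rightarrow> real measure"
    and s \<tau> x :: real
  assumes P: "prob_space M"
    and meas: "\<And>i. X i \<in> borel_measurable M" "\<And>i. Y i \<in> borel_measurable M"
    and indep: "prob_space.indep_vars M (\<lambda>_. borel :: (real \<times> real) measure)
                  (\<lambda>i \<omega>. (X i \<omega>, Y i \<omega>)) UNIV"
    and ident: "\<And>i. distr M borel (\<lambda>\<omega>. (X i \<omega>, Y i \<omega>)) = distr M borel (\<lambda>\<omega>. (X 0 \<omega>, Y 0 \<omega>))"
    and H_cont: "continuous_on UNIV (\<lambda>(a, b). measure M {\<omega> \<in> space M. X 0 \<omega> \<le> a \<and> Y 0 \<omega> \<le> b})"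
    and A_cop: "is_copula A"
    and sklar: "\<And>a b. measure M {\<omega> \<in> space M. X 0 \<omega> \<le> a \<and> Y 0 \<omega> \<le> b} =
                 A (measure M {\<omega> \<in> space M. X 0 \<omega> \<le> a}) (measure M {\<omega> \<in> space M. Y 0 \<omega> \<le> b})"
    and K_cont: "is_continuous_markov_kernel A K"
    and s: "0 < s" "s < 1 / 2"
    and tau: "0 < \<tau>" "\<tau> < 1"
  shows "AE \<omega> in M.
    (let F = (\<lambda>t. measure M {\<omega> \<in> space M. X 0 \<omega> \<le> t});
         G = (\<lambda>t. measure M {\<omega> \<in> space M. Y 0 \<omega> \<le> t});
         KH = (\<lambda>t. measure (K (F x)) {0..G t});
         ql = Sup {y. KH y < \<tau>};
         qu = Inf {y. KH y > \<tau>};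
         Kn = (\<lambda>n t. cb_kernel (nat \<lfloor>real n powr s\<rfloor>)
                 (emp_copula (\<lambda>i. X i \<omega>) (\<lambda>i. Y i \<omega>) n)
                 (emp_df (\<lambda>i. X i \<omega>) n x) (emp_df (\<lambda>i. Y i \<omega>) n t));
         qln = (\<lambda>n. Sup {y. Kn n y < \<tau>});
         qun = (\<lambda>n. Inf {y. Kn n y > \<tau>})
     in ((\<lambda>n. SUP yn \<in> {qln n..qun n}. INF y \<in> {ql..qu}. \<bar>yn - y\<bar>) \<longlonglongrightarrow> 0))"
proof -
  interpret copula_sample M X Y A
    by (intro copula_sample.intro copula_sample_axioms.intro P meas indep ident H_cont A_cop sklar)
  have KF: "prob_space (K (F x))" "sets (K (F x)) = sets borel" "measure (K (F x)) {0..1} = 1"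
    using K_cont F_unit[of x] unfolding is_continuous_markov_kernel_def is_markov_kernel_def by auto
  let ?KH = "\<lambda>t. measure (K (F x)) {0..G t}"
  have mono: "mono ?KH"
    using KF by (intro monoI finite_measure.finite_measure_mono prob_space.finite_measure)
      (auto dest: monoD[OF G_props(1)])
  \<comment> \<open>Far to the left G y is near 0, where the continuous kernel has the value 0; the
    tolerance \<open>\<tau>\<close> is exactly what is available.\<close>
  have low: "\<exists>y. ?KH y < \<tau>"
  proof -
    obtain d where d: "d > 0" "\<And>t w. t \<in> {0..1} \<Longrightarrow> w \<in> {0..1} \<Longrightarrow> \<bar>t - F x\<bar> < d \<Longrightarrow> \<bar>w - 0\<bar> < d \<Longrightarrow>
       \<bar>measure (K t) {0..w} - measure (K (F x)) {0..0}\<bar> < \<tau>"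
      using kernel_near[OF K_cont F_unit[of x], of 0 \<tau>] tau by auto
    obtain y where "G y < d"
      using eventually_happens'[OF trivial_limit_at_bot_linorder order_tendstoD(2)[OF G_props(4) d(1)]] by blast
    then have "\<bar>?KH y - measure (K (F x)) {0..0}\<bar> < \<tau>"
      using d(1) G_unit[of y] F_unit by (intro d(2)) auto
    then show ?thesis
      using continuous_markov_kernel_at_0[OF A_cop is_dsm_copula K_cont F_unit[of x]] by (intro exI[of _ y]) linarith
  qed
  \<comment> \<open>Far to the right the kernel is near its total mass 1, which leaves the tolerance
    \<open>1 - \<tau>\<close>.\<close>
  have high: "\<exists>y. ?KH y > \<tau>"
  proof -
    obtain d where d: "d > 0" "\<And>t w. t \<in> {0..1} \<Longrightarrow> w \<in> {0..1} \<Longrightarrow> \<bar>t - F x\<bar> < d \<Longrightarrow> \<bar>w - 1\<bar> < d \<Longrightarrow>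
       \<bar>measure (K t) {0..w} - measure (K (F x)) {0..1}\<bar> < 1 - \<tau>"
      using kernel_near[OF K_cont F_unit[of x], of 1 "1 - \<tau>"] tau by auto
    have "1 - d < 1" using d(1) by simp
    then obtain y where "1 - d < G y"
      using eventually_happens'[OF trivial_limit_at_top_linorder order_tendstoD(1)[OF G_props(3)]] by blast
    then have "\<bar>?KH y - measure (K (F x)) {0..1}\<bar> < 1 - \<tau>"
      using d(1) G_unit[of y] F_unit by (intro d(2)) auto
    then show ?thesis using KF(3) by (intro exI[of _ y]) linarith
  qed
  show ?thesis
    unfolding Let_def F_def[symmetric] G_def[symmetric]
    using cb_kernel_converges[OF K_cont s]
  proof eventually_elim
    case (elim \<omega>)
    show ?case
    proof (rule quantile_interval_tendsto[OF mono _ low high])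
      have "emp_df y n a \<le> emp_df y n b" if "a \<le> b" for y n a b
        using that unfolding emp_df_def by (intro divide_right_mono of_nat_mono card_mono) auto
      then show "mono (\<lambda>t. cb_kernel (nat \<lfloor>real n powr s\<rfloor>) (emp_copula (\<lambda>i. X i \<omega>) (\<lambda>i. Y i \<omega>) n)
                 (emp_df (\<lambda>i. X i \<omega>) n x) (emp_df (\<lambda>i. Y i \<omega>) n t))" for n
        by (intro monoI cb_kernel_mono)
    qed (use elim in blast)
  qed
qed

end
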